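(* Let $H$ be a complex separable Hilbert space and let $S\in\mathfrak{B}(H)$. The following properties are equivalent: (i) $S$ is normal; (ii) $|S^{2}|=|S|^{2}$ and $|S^{*2}|=|S^{*}|^{2}$; (iii) $|S^{2}|^{2}\geq |S|^{4}$ and $|S^{*2}|^{2}\geq |S^{*}|^{4}$; (iv) $S$ and $S^{*}$ belong to class $\mathbf{A}$; (v) $S$ and $S^{*}$ are paranormal.
   Context: $\mathfrak{B}(H)$ denotes the C*-algebra of all bounded linear operators on $H$. For $T\in\mathfrak{B}(H)$, $|T|$ is the positive square root of the positive operator $T^{*}T$, and $S^{*2}=(S^{*})^{2}$. Operator inequalities $A\ge B$ between selfadjoint operators mean that $A-B$ is positive (semidefinite). An operator $T\in\mathfrak{B}(H)$ belongs to class $\mathbf{A}$ if $|T^{2}|\geq |T|^{2}$. An operator $T\in\mathfrak{B}(H)$ is paranormal if $\|x\|\,\|T^{2}x\|\geq \|Tx\|^{2}$ for every $x\in H$. *)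

theory Defs
  imports "HOL-Analysis.Analysis"
begin

text \<open>
  Complex inner product spaces are modelled over the library class \<^class>\<open>real_inner\<close>: the
  underlying real inner product is the real part of the complex one, so that
  \<open>norm x = sqrt (Re (cinner x x))\<close>, and the library's norm, topology and boundedness are those of
  the complex space. The complex inner product is linear in its first argument.
\<close>

class complex_inner = real_inner +
  fixes scaleC :: "complex \<Rightarrow> 'a \<Rightarrow> 'a"  (infixr \<open>*\<^sub>C\<close> 75)
    and cinner :: "'a \<Rightarrow> 'a \<Rightarrow> complex"
  assumes scaleR_scaleC: "r *\<^sub>R x = complex_of_real r *\<^sub>C x"
    and scaleC_add_right: "a *\<^sub>C (x + y) = a *\<^sub>C x + a *\<^sub>C y"
    and scaleC_add_left: "(a + b) *\<^sub>C x = a *\<^sub>C x + b *\<^sub>C x"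
    and scaleC_scaleC: "a *\<^sub>C b *\<^sub>C x = (a * b) *\<^sub>C x"
    and cinner_commute: "cinner x y = cnj (cinner y x)"
    and cinner_add_left: "cinner (x + y) z = cinner x z + cinner y z"
    and cinner_scaleC_left: "cinner (a *\<^sub>C x) y = a * cinner x y"
    and inner_eq_Re_cinner: "inner x y = Re (cinner x y)"

class chilbert_space = complex_inner + complete_space

instantiation complex :: chilbert_space
begin

definition scaleC_complex_def: "a *\<^sub>C (x::complex) = a * x"

definition cinner_complex_def: "cinner (x::complex) y = x * cnj y"

instance
  by standard
    (simp_all add: scaleC_complex_def cinner_complex_def inner_complex_def
      scaleR_conv_of_real algebra_simps)

end

definition bounded_clinear :: "('a::complex_inner \<Rightarrow> 'b::complex_inner) \<Rightarrow> bool" where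
  "bounded_clinear T \<longleftrightarrow> bounded_linear T \<and> (\<forall>c x. T (c *\<^sub>C x) = c *\<^sub>C T x)"

definition cadjoint :: "('a::chilbert_space \<Rightarrow> 'a) \<Rightarrow> 'a \<Rightarrow> 'a" where
  "cadjoint T = (THE U. \<forall>x y. cinner (T x) y = cinner x (U y))"

text \<open>
  Membership in \<open>\<real>\<^sub>\<ge>\<^sub>0\<close> says that the complex number \<open>cinner (A x) x\<close> is real and nonnegative;
  over the complex field this already makes \<open>A\<close> selfadjoint.
\<close>

definition positive_op :: "('a::chilbert_space \<Rightarrow> 'a) \<Rightarrow> bool" where
  "positive_op A \<longleftrightarrow> bounded_clinear A \<and> (\<forall>x. cinner (A x) x \<in> \<real>\<^sub>\<ge>\<^sub>0)"

definition op_ge :: "('a::chilbert_space \<Rightarrow> 'a) \<Rightarrow> ('a \<Rightarrow> 'a) \<Rightarrow> bool"  (infix \<open>\<ge>\<^sub>o\<^sub>p\<close> 50) where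
  "A \<ge>\<^sub>o\<^sub>p B \<longleftrightarrow> positive_op (\<lambda>x. A x - B x)"

definition op_sqrt :: "('a::chilbert_space \<Rightarrow> 'a) \<Rightarrow> 'a \<Rightarrow> 'a" where
  "op_sqrt P = (THE R. positive_op R \<and> R \<circ> R = P)"

definition op_abs :: "('a::chilbert_space \<Rightarrow> 'a) \<Rightarrow> 'a \<Rightarrow> 'a" where
  "op_abs T = op_sqrt (cadjoint T \<circ> T)"

definition normal_op :: "('a::chilbert_space \<Rightarrow> 'a) \<Rightarrow> bool" where
  "normal_op T \<longleftrightarrow> cadjoint T \<circ> T = T \<circ> cadjoint T"

text \<open>On operators, \<open>T ^^ n\<close> is the \<open>n\<close>-fold composition, that is, the \<open>n\<close>-th power of \<open>T\<close>.\<close>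

definition class_A :: "('a::chilbert_space \<Rightarrow> 'a) \<Rightarrow> bool" where
  "class_A T \<longleftrightarrow> op_abs (T ^^ 2) \<ge>\<^sub>o\<^sub>p op_abs T ^^ 2"

definition paranormal :: "('a::chilbert_space \<Rightarrow> 'a) \<Rightarrow> bool" where
  "paranormal T \<longleftrightarrow> (\<forall>x. norm x * norm ((T ^^ 2) x) \<ge> (norm (T x))\<^sup>2)"

end

theory Submission
  imports Defs
begin

text \<open>
  The only hard implication is that \<open>S\<close> is normal if \<open>S\<close> and \<open>U = S\<^sup>*\<close> are paranormal. Let
  \<open>A = U S\<close>, \<open>B = S U\<close> and \<open>N = |S\<^sup>2|\<close>. The two paranormality conditions, at \<open>x\<close> and at \<open>S\<^sup>2 x\<close>,
  combine to \<open>2 l \<parallel>(A - l) S x\<parallel>\<^sup>2 \<le> \<parallel>(N\<^sup>2 - l\<^sup>2) x\<parallel>\<^sup>2\<close> for all \<open>l > 0\<close>. So \<open>K = A S - S N\<close> is small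
  wherever \<open>N\<close> is close to \<open>l\<close>: \<open>\<parallel>K N x\<parallel> \<le> C \<parallel>(N - l) x\<parallel>\<close> for all \<open>l\<close> in an interval containing the
  spectrum of \<open>N\<close>. Cutting the spectrum into \<open>n\<close> pieces bounds \<open>\<parallel>K N\<parallel>\<close> by a multiple of \<open>n powr (-1/2)\<close>,
  so \<open>K N = 0\<close>, and then \<open>N = A\<close>. The decomposition is made without the spectral theorem:
  \<open>N\<close>, scaled to a contraction, is the real part of the unitary \<open>W = N + \<i> sqrt (1 - N\<^sup>2)\<close>, and averages of powers of \<open>W\<close>
  against \<open>n\<close>-th roots of unity replace the spectral projections.

  By symmetry \<open>|U\<^sup>2| = B\<close>. Hence \<open>A B A = A\<^sup>3\<close> and \<open>B A B = B\<^sup>3\<close>, so that \<open>A\<^sup>2\<close> and \<open>B\<^sup>2\<close> are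
  intertwined by \<open>A B\<close>. Passing to square roots gives \<open>A\<^sup>2 B = A B\<^sup>2\<close>, and \<open>(A - B)\<^sup>3 = 0\<close>.
\<close>

section \<open>Adjoint pairs and positive operators over the real inner product\<close>

instance chilbert_space \<subseteq> banach ..

text \<open>A relation for the real inner product lets the theory of square roots avoid complex
  scalars; \<open>adjoint_pair_clinear\<close> recovers the complex identity.\<close>

definition adjoint_pair :: "('a::real_inner \<Rightarrow> 'a) \<Rightarrow> ('a \<Rightarrow> 'a) \<Rightarrow> bool" where
  "adjoint_pair T U \<longleftrightarrow> bounded_linear T \<and> bounded_linear U \<and> (\<forall>x y. inner (T x) y = inner x (U y))"

text \<open>Over the reals a nonnegative quadratic form does not force symmetry (a quarter turn of
  the plane has form zero), hence the first conjunct.\<close>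

definition psd_op :: "('a::real_inner \<Rightarrow> 'a) \<Rightarrow> bool" where
  "psd_op A \<longleftrightarrow> adjoint_pair A A \<and> (\<forall>x. 0 \<le> inner (A x) x)"

lemma adjoint_pairD:
  assumes "adjoint_pair T U"
  shows "bounded_linear T" "bounded_linear U" "inner (T x) y = inner x (U y)"
  using assms by (auto simp: adjoint_pair_def)

lemma adjoint_pair_flip: "adjoint_pair T U \<Longrightarrow> adjoint_pair U T"
  unfolding adjoint_pair_def by (metis inner_commute)

lemma psd_opD:
  assumes "psd_op A"
  shows "bounded_linear A" "inner (A x) y = inner x (A y)" "0 \<le> inner (A x) x" "adjoint_pair A A"
  using assms by (auto simp: psd_op_def adjoint_pair_def)

lemma inner_right_eqI: "(\<And>x. inner x a = inner x b) \<Longrightarrow> a = b" for a b :: "'a::real_inner"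
  by (metis inner_diff_right inner_eq_zero_iff right_minus_eq)

lemma adjoint_pair_norm_bound:
  assumes "adjoint_pair T U" and "\<And>x. norm (T x) \<le> k * norm x"
  shows "norm (U x) \<le> k * norm x"
proof -
  have "norm (U x) * norm (U x) = inner (T (U x)) x"
    by (simp add: adjoint_pairD(3)[OF assms(1)] dot_square_norm power2_eq_square)
  also have "\<dots> \<le> norm (T (U x)) * norm x"
    by (rule norm_cauchy_schwarz)
  also have "\<dots> \<le> k * norm (U x) * norm x"
    by (intro mult_right_mono assms(2)) simp
  finally have "norm (U x) * norm (U x) \<le> norm (U x) * (k * norm x)" by (simp add: algebra_simps)
  moreover have "0 \<le> k * norm x" using assms(2)[of x] norm_ge_zero order_trans by blast
  ultimately show ?thesis by (cases "norm (U x) = 0") auto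
qed

lemma symmetric_square_zero:
  assumes "adjoint_pair D D" and "D (D x) = 0"
  shows "D x = 0"
proof -
  have "inner (D x) (D x) = inner (D (D x)) x"
    by (metis adjoint_pairD(3)[OF assms(1)])
  then show ?thesis using assms(2) by simp
qed

lemma psd_op_zero:
  assumes A: "psd_op A" and "inner (A x) x = 0"
  shows "A x = 0"
proof (rule ccontr)
  note L = psd_opD(1)[OF A, THEN bounded_linear.linear]
  define y where "y = A x"
  define a b where "a = inner y y" and "b = inner (A y) y"
  assume "A x \<noteq> 0"
  then have a: "a > 0" by (simp add: a_def y_def)
  have b: "b \<ge> 0" using psd_opD(3)[OF A] by (simp add: b_def)
  \<comment> \<open>The form at \<open>x + t *\<^sub>R y\<close> is \<open>2 t a + t^2 b\<close>,
    negative for small negative \<open>t\<close>; the \<open>+ 1\<close> keeps the denominator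
    positive if \<open>b = 0\<close>.\<close>
  define t where "t = - a / (b + 1)"
  have *: "inner (A (x + t *\<^sub>R y)) (x + t *\<^sub>R y) = 2 * t * a + t * t * b"
    using assms(2) psd_opD(2)[OF A, of y x] psd_opD(2)[OF A, of x y]
    by (simp add: linear_add[OF L] linear_scale[OF L] inner_add_left inner_add_right
        a_def b_def y_def[symmetric] algebra_simps inner_commute)
  have "0 \<le> 2 * t * a + t * t * b" using psd_opD(3)[OF A] unfolding *[symmetric] .
  also have "\<dots> = (a * a / ((b + 1) * (b + 1))) * (b - 2 * (b + 1))"
    unfolding t_def using b by (simp add: divide_simps) (simp add: algebra_simps)
  also have "\<dots> < 0" using a b by (intro mult_pos_neg) auto
  finally show False by simp
qed

subsection \<open>Square roots of positive operators\<close>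

text \<open>For \<open>norm D \<le> 1\<close> the iterates converge to \<open>1 - sqrt (1 - D)\<close>.\<close>

fun sqrt_iter :: "('a::real_normed_vector \<Rightarrow>\<^sub>L 'a) \<Rightarrow> nat \<Rightarrow> 'a \<Rightarrow>\<^sub>L 'a" where
  "sqrt_iter D 0 = 0"
| "sqrt_iter D (Suc n) = (1/2) *\<^sub>R (D + (sqrt_iter D n o\<^sub>L sqrt_iter D n))"

text \<open>The scalar iteration for \<open>D = 1\<close>, which increases within
  \<open>[0, 1]\<close> and dominates the operator iteration.\<close>

fun sqrt_majorant :: "nat \<Rightarrow> real" where
  "sqrt_majorant 0 = 0"
| "sqrt_majorant (Suc n) = (1 + sqrt_majorant n * sqrt_majorant n) / 2"

lemma sqrt_majorant_bounds: "0 \<le> sqrt_majorant n" "sqrt_majorant n \<le> 1"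
proof (induction n)
  case (Suc n)
  case 1 show ?case using Suc by simp
  case 2 show ?case using mult_mono[OF Suc(2) Suc(2)] Suc by simp
qed auto

text \<open>The splitting \<open>Z^2 - Y^2 = Z (Z - Y) + (Z - Y) Y\<close> bounds operator
  increments by the scalar ones without commutativity. The increment estimate uses the norm bounds,
  so both are carried through one induction.\<close>

lemma norm_sqrt_iter_diff:
  assumes "norm D \<le> 1"
  shows "norm (sqrt_iter D n) \<le> sqrt_majorant n \<and>
    norm (sqrt_iter D (Suc n) - sqrt_iter D n) \<le> sqrt_majorant (Suc n) - sqrt_majorant n"
proof (induction n)
  case 0
  show ?case using assms by simp
next
  case (Suc n)
  define Y Z s t where "Y = sqrt_iter D n" and "Z = sqrt_iter D (Suc n)"
    and "s = sqrt_majorant n" and "t = sqrt_majorant (Suc n)"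
  have Y: "norm Y \<le> s" and ZY: "norm (Z - Y) \<le> t - s"
    using Suc unfolding Y_def Z_def s_def t_def by auto
  have Z: "norm Z \<le> t" using norm_triangle_ineq[of "Z - Y" Y] Y ZY by simp
  have "sqrt_iter D (Suc (Suc n)) - Z = (1/2) *\<^sub>R ((Z o\<^sub>L Z) - (Y o\<^sub>L Y))"
    using Y_def Z_def by (simp add: algebra_simps)
  also have "(Z o\<^sub>L Z) - (Y o\<^sub>L Y) = (Z o\<^sub>L (Z - Y)) + ((Z - Y) o\<^sub>L Y)"
    by (rule blinfun_eqI) (simp add: blinfun.diff_left blinfun.add_left blinfun.diff_right)
  finally have "norm (sqrt_iter D (Suc (Suc n)) - Z) = (1/2) * norm ((Z o\<^sub>L (Z - Y)) + ((Z - Y) o\<^sub>L Y))"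
    by simp
  also have "\<dots> \<le> (1/2) * (norm Z * norm (Z - Y) + norm (Z - Y) * norm Y)"
    by (intro mult_left_mono norm_triangle_le add_mono norm_blinfun_compose) auto
  also have "\<dots> \<le> (1/2) * (t * (t - s) + (t - s) * s)"
    using Y Z ZY order_trans[OF norm_ge_zero Y] order_trans[OF norm_ge_zero Z] order_trans[OF norm_ge_zero ZY]
    by (intro mult_left_mono add_mono mult_mono) simp_all
  also have "\<dots> = sqrt_majorant (Suc (Suc n)) - t"
    unfolding s_def t_def sqrt_majorant.simps(2)[of "Suc n"]
    by (simp add: field_simps)
  finally show ?case using Z unfolding Z_def t_def by simp
qed

definition sqrt_compl :: "('a::banach \<Rightarrow>\<^sub>L 'a) \<Rightarrow> 'a \<Rightarrow>\<^sub>L 'a" where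
  "sqrt_compl D = id_blinfun - lim (sqrt_iter D)"

text \<open>The increments are dominated by those of a bounded increasing real sequence, hence
  summable in a Banach space of operators.\<close>

lemma sqrt_iter_LIMSEQ:
  fixes D :: "'a::banach \<Rightarrow>\<^sub>L 'a"
  assumes "norm D \<le> 1"
  shows "sqrt_iter D \<longlonglongrightarrow> id_blinfun - sqrt_compl D"
proof -
  have "sqrt_majorant n \<le> sqrt_majorant (Suc n)" for n
    using conjunct2[OF norm_sqrt_iter_diff[OF assms, of n]]
      norm_ge_zero[of "sqrt_iter D (Suc n) - sqrt_iter D n"] by linarith
  then have "incseq sqrt_majorant" by (rule incseq_SucI)
  then have "convergent sqrt_majorant"
    using sqrt_majorant_bounds(2) incseq_convergent convergentI by metis
  then have "summable (\<lambda>n. sqrt_majorant (Suc n) - sqrt_majorant n)"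
    using telescope_summable convergent_def by blast
  then have "summable (\<lambda>n. sqrt_iter D (Suc n) - sqrt_iter D n)"
    by (rule summable_comparison_test') (use norm_sqrt_iter_diff[OF assms] in blast)
  then have "convergent (\<lambda>n. \<Sum>i<n. sqrt_iter D (Suc i) - sqrt_iter D i)"
    by (simp add: summable_iff_convergent)
  then have "convergent (sqrt_iter D)"
    by (simp only: sum_lessThan_telescope) simp
  then show ?thesis by (simp add: sqrt_compl_def convergent_LIMSEQ_iff)
qed

lemma sqrt_compl_square:
  fixes D :: "'a::banach \<Rightarrow>\<^sub>L 'a"
  assumes "norm D \<le> 1"
  shows "sqrt_compl D (sqrt_compl D x) = x - D x"
proof -
  define Y where "Y = id_blinfun - sqrt_compl D"
  note lim = sqrt_iter_LIMSEQ[OF assms, folded Y_def]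
  have "(\<lambda>n. sqrt_iter D (Suc n)) \<longlonglongrightarrow> (1/2) *\<^sub>R (D + (Y o\<^sub>L Y))"
    unfolding sqrt_iter.simps by (intro tendsto_intros lim)
  moreover have "(\<lambda>n. sqrt_iter D (Suc n)) \<longlonglongrightarrow> Y"
    using lim by (rule LIMSEQ_Suc)
  ultimately have Y: "Y = (1/2) *\<^sub>R (D + (Y o\<^sub>L Y))"
    using LIMSEQ_unique by blast
  \<comment> \<open>The fixed point equation \<open>2 Y = D + Y^2\<close> is
    \<open>(1 - Y)^2 = 1 - D\<close>.\<close>
  have "2 *\<^sub>R Y = D + (Y o\<^sub>L Y)"
    by (subst Y) simp
  then have "blinfun_apply (2 *\<^sub>R Y) x = (D + (Y o\<^sub>L Y)) x"
    by (rule arg_cong)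
  then have eq: "2 *\<^sub>R Y x = D x + Y (Y x)"
    by (simp add: blinfun.add_left blinfun.scaleR_left)
  have "sqrt_compl D z = z - Y z" for z by (simp add: Y_def blinfun.diff_left)
  then have "sqrt_compl D (sqrt_compl D x) = x - (2 *\<^sub>R Y x - Y (Y x))"
    by (simp add: blinfun.diff_right scaleR_2)
  then show ?thesis by (simp add: eq)
qed

text \<open>Every iterate is a polynomial in its operator, so the relation passes to the iterates
  and then to the limit.\<close>

lemma sqrt_compl_intertwine:
  fixes D E :: "'a::banach \<Rightarrow>\<^sub>L 'a"
  assumes "norm D \<le> 1" "norm E \<le> 1" and T: "bounded_linear T" and DE: "\<And>x. D (T x) = T (E x)"
  shows "sqrt_compl D (T x) = T (sqrt_compl E x)"
proof -
  note TL = bounded_linear.linear[OF T]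
  have "sqrt_iter D n (T x) = T (sqrt_iter E n x)" for n x
    by (induction n arbitrary: x)
      (simp_all add: DE blinfun.add_left blinfun.scaleR_left linear_0[OF TL] linear_add[OF TL] linear_scale[OF TL])
  moreover have "(\<lambda>n. sqrt_iter D n (T x)) \<longlonglongrightarrow> (id_blinfun - sqrt_compl D) (T x)"
    by (intro tendsto_intros sqrt_iter_LIMSEQ assms)
  moreover have "(\<lambda>n. T (sqrt_iter E n x)) \<longlonglongrightarrow> T ((id_blinfun - sqrt_compl E) x)"
    by (intro tendsto_intros sqrt_iter_LIMSEQ assms bounded_linear.tendsto[OF T])
  ultimately have "(id_blinfun - sqrt_compl D) (T x) = T ((id_blinfun - sqrt_compl E) x)"
    using LIMSEQ_unique by simp
  then show ?thesis by (simp add: blinfun.diff_left linear_diff[OF TL])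
qed

lemma sqrt_compl_psd:
  fixes D :: "'a::{real_inner, banach} \<Rightarrow>\<^sub>L 'a"
  assumes D: "norm D \<le> 1" and sym: "\<And>x y. inner (D x) y = inner x (D y)"
  shows "psd_op (sqrt_compl D)"
proof -
  define Y where "Y = id_blinfun - sqrt_compl D"
  note lim = sqrt_iter_LIMSEQ[OF D, folded Y_def]
  have eq: "inner (sqrt_iter D n x) y = inner x (sqrt_iter D n y)" for n x y
    by (induction n arbitrary: x y)
      (simp_all add: sym blinfun.add_left blinfun.scaleR_left inner_add_left inner_add_right)
  have Ysym: "inner (Y x) y = inner x (Y y)" for x y
  proof (rule LIMSEQ_unique)
    show "(\<lambda>n. inner (sqrt_iter D n x) y) \<longlonglongrightarrow> inner (Y x) y"
      by (intro tendsto_intros lim)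
    show "(\<lambda>n. inner (sqrt_iter D n x) y) \<longlonglongrightarrow> inner x (Y y)"
      unfolding eq by (intro tendsto_intros lim)
  qed
  have "norm (sqrt_iter D n) \<le> 1" for n
    using norm_sqrt_iter_diff[OF D] sqrt_majorant_bounds(2) order_trans by blast
  then have nY: "norm Y \<le> 1"
    using LIMSEQ_le_const2[OF tendsto_norm[OF lim]] by blast
  have "inner (Y x) x \<le> inner x x" for x
  proof -
    have "inner (Y x) x \<le> norm (Y x) * norm x" by (rule norm_cauchy_schwarz)
    also have "\<dots> \<le> (norm Y * norm x) * norm x" by (intro mult_right_mono norm_blinfun) simp
    also have "\<dots> \<le> (1 * norm x) * norm x" by (intro mult_right_mono nY) simp_all
    finally show ?thesis by (simp add: dot_square_norm power2_eq_square)
  qed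
  moreover have "sqrt_compl D = id_blinfun - Y" by (simp add: Y_def)
  ultimately show ?thesis
    by (simp add: psd_op_def adjoint_pair_def blinfun.bounded_linear_right blinfun.diff_left
        inner_diff_left inner_diff_right Ysym)
qed

text \<open>The square root of \<open>P\<close>, provided that \<open>P = T\<^sup>*T\<close> with \<open>norm T \<le> k\<close>.\<close>

definition scaled_sqrt :: "real \<Rightarrow> ('a::banach \<Rightarrow> 'a) \<Rightarrow> 'a \<Rightarrow> 'a" where
  "scaled_sqrt k P x = k *\<^sub>R sqrt_compl (id_blinfun - (1 / k\<^sup>2) *\<^sub>R Blinfun P) x"

text \<open>The operator \<open>U T / k^2\<close> lies between 0 and 1, so its complement is a
  symmetric contraction, as \<open>sqrt_compl\<close> requires.\<close>

lemma scaled_sqrt_defect: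
  fixes T :: "'a::{real_inner, banach} \<Rightarrow> 'a"
  assumes adj: "adjoint_pair T U" and k: "k > 0" "\<And>x. norm (T x) \<le> k * norm x"
  defines "D \<equiv> id_blinfun - (1 / k\<^sup>2) *\<^sub>R Blinfun (\<lambda>x. U (T x))"
  shows "D x = x - (1 / k\<^sup>2) *\<^sub>R U (T x)" and "norm D \<le> 1" and "inner (D x) y = inner x (D y)"
proof -
  have "bounded_linear (\<lambda>x. U (T x))"
    using bounded_linear_compose[OF adjoint_pairD(2)[OF adj] adjoint_pairD(1)[OF adj]] by (simp add: o_def)
  then show D: "D x = x - (1 / k\<^sup>2) *\<^sub>R U (T x)" for x
    by (simp add: D_def blinfun.diff_left blinfun.scaleR_left bounded_linear_Blinfun_apply)
  have UT: "inner (U (T x)) y = inner (T x) (T y)" for x y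
    by (metis adj adjoint_pairD(3) inner_commute)
  show "inner (D x) y = inner x (D y)"
    using UT[of x y] UT[of y x] by (simp add: D inner_diff_left inner_diff_right inner_commute)
  show "norm D \<le> 1"
  proof (rule norm_blinfun_bound)
    fix x
    have "norm (U (T x)) \<le> k * norm (T x)"
      by (rule adjoint_pair_norm_bound[OF adj k(2)])
    then have "(norm (U (T x)))\<^sup>2 \<le> (k * norm (T x))\<^sup>2"
      by (intro power_mono) auto
    then have *: "inner (U (T x)) (U (T x)) \<le> k\<^sup>2 * inner (T x) (T x)"
      by (simp add: dot_square_norm power_mult_distrib)
    have "inner (D x) (D x) = inner x x - 2 * (1 / k\<^sup>2) * inner (T x) (T x) + (1 / k\<^sup>2) * (1 / k\<^sup>2) * inner (U (T x)) (U (T x))"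
      using UT[of x x] by (simp add: D inner_diff_left inner_diff_right inner_commute)
    also have "\<dots> \<le> inner x x - 2 * (1 / k\<^sup>2) * inner (T x) (T x) + (1 / k\<^sup>2) * (1 / k\<^sup>2) * (k\<^sup>2 * inner (T x) (T x))"
      using * by (intro add_left_mono mult_left_mono) auto
    also have "\<dots> = inner x x - (1 / k\<^sup>2) * inner (T x) (T x)"
      using k by (simp add: field_simps)
    also have "\<dots> \<le> inner x x" by simp
    finally show "norm (D x) \<le> 1 * norm x" by (simp add: norm_le)
  qed simp
qed

lemma scaled_sqrt_square:
  fixes T :: "'a::{real_inner, banach} \<Rightarrow> 'a"
  assumes adj: "adjoint_pair T U" and k: "k > 0" "\<And>x. norm (T x) \<le> k * norm x"
  shows "scaled_sqrt k (\<lambda>x. U (T x)) (scaled_sqrt k (\<lambda>x. U (T x)) x) = U (T x)"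
  using k by (simp add: scaled_sqrt_def blinfun.scaleR_right sqrt_compl_square[OF scaled_sqrt_defect(2)[OF assms]]
      scaled_sqrt_defect(1)[OF assms] scaleR_diff_right power2_eq_square[symmetric])

lemma psd_op_scale:
  assumes "psd_op A" "0 \<le> c"
  shows "psd_op (\<lambda>x. c *\<^sub>R A x)"
  using assms by (auto simp add: psd_op_def adjoint_pair_def bounded_linear_const_scaleR)

lemma scaled_sqrt_psd:
  fixes T :: "'a::{real_inner, banach} \<Rightarrow> 'a"
  assumes adj: "adjoint_pair T U" and k: "k > 0" "\<And>x. norm (T x) \<le> k * norm x"
  shows "psd_op (scaled_sqrt k (\<lambda>x. U (T x)))"
  unfolding scaled_sqrt_def using k
  by (intro psd_op_scale sqrt_compl_psd scaled_sqrt_defect[OF assms]) auto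

lemma scaled_sqrt_intertwine:
  fixes T T' :: "'a::{real_inner, banach} \<Rightarrow> 'a"
  assumes k: "k > 0"
    and T: "adjoint_pair T U" "\<And>x. norm (T x) \<le> k * norm x"
    and T': "adjoint_pair T' U'" "\<And>x. norm (T' x) \<le> k * norm x"
    and Z: "bounded_linear Z" and eq: "\<And>x. U (T (Z x)) = Z (U' (T' x))"
  shows "scaled_sqrt k (\<lambda>x. U (T x)) (Z x) = Z (scaled_sqrt k (\<lambda>x. U' (T' x)) x)"
proof -
  note ZL = bounded_linear.linear[OF Z]
  show ?thesis unfolding scaled_sqrt_def linear_scale[OF ZL]
    by (subst sqrt_compl_intertwine[OF scaled_sqrt_defect(2)[OF T(1) k T(2)] scaled_sqrt_defect(2)[OF T'(1) k T'(2)] Z])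
      (simp_all add: scaled_sqrt_defect(1)[OF T(1) k T(2)] scaled_sqrt_defect(1)[OF T'(1) k T'(2)]
        eq linear_diff[OF ZL] linear_scale[OF ZL])
qed

text \<open>For \<open>y = (R - Q) x\<close>, commutation and equal squares give
  \<open>(R + Q) y = 0\<close>. Both quadratic forms then vanish at \<open>y\<close>, so
  \<open>R y = Q y = 0\<close> and \<open>inner y y = inner ((R - Q) y) x = 0\<close>.\<close>

lemma psd_sqrt_unique_commuting:
  assumes R: "psd_op R" and Q: "psd_op Q" and comm: "\<And>x. R (Q x) = Q (R x)"
    and eq: "\<And>x. R (R x) = Q (Q x)"
  shows "R x = Q x"
proof -
  note RL = psd_opD(1)[OF R, THEN bounded_linear.linear]
  note QL = psd_opD(1)[OF Q, THEN bounded_linear.linear]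
  define y where "y = R x - Q x"
  have "R y + Q y = 0"
    by (simp add: y_def linear_diff[OF RL] linear_diff[OF QL] comm eq)
  then have "inner (R y) y + inner (Q y) y = 0"
    by (metis inner_add_left inner_zero_left)
  then have "R y = 0" "Q y = 0"
    using psd_opD(3)[OF R, of y] psd_opD(3)[OF Q, of y] psd_op_zero[OF R] psd_op_zero[OF Q] by simp_all
  moreover have "inner y y = inner (R y) x - inner (Q y) x"
    by (simp add: y_def inner_diff_right psd_opD(2)[OF R] psd_opD(2)[OF Q] linear_diff[OF RL] linear_diff[OF QL] inner_diff_left)
  ultimately show ?thesis by (simp add: y_def)
qed

text \<open>The constructed root of \<open>A^2\<close> commutes with everything that commutes with
  \<open>A^2\<close>, in particular with \<open>A\<close>, so uniqueness among commuting roots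
  applies.\<close>

lemma psd_op_eq_scaled_sqrt:
  fixes A :: "'a::{real_inner, banach} \<Rightarrow> 'a"
  assumes A: "psd_op A" and k: "k > 0" "\<And>x. norm (A x) \<le> k * norm x"
  shows "A = scaled_sqrt k (\<lambda>x. A (A x))"
proof (rule ext, rule sym, rule psd_sqrt_unique_commuting[OF _ A])
  note AA = psd_opD(4)[OF A]
  show "psd_op (scaled_sqrt k (\<lambda>x. A (A x)))" by (rule scaled_sqrt_psd[OF AA k])
  show "scaled_sqrt k (\<lambda>x. A (A x)) (A x) = A (scaled_sqrt k (\<lambda>x. A (A x)) x)" for x
    by (rule scaled_sqrt_intertwine[OF k(1) AA k(2) AA k(2) psd_opD(1)[OF A]]) simp
  show "scaled_sqrt k (\<lambda>x. A (A x)) (scaled_sqrt k (\<lambda>x. A (A x)) x) = A (A x)" for x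
    by (rule scaled_sqrt_square[OF AA k])
qed

lemma bounded_linear_pos_bound:
  assumes "bounded_linear T"
  obtains k where "k > 0" "\<And>x. norm (T x) \<le> k * norm x"
  using bounded_linear.pos_bounded[OF assms] by (metis mult.commute)

text \<open>Both operators are rewritten as constructed roots of their squares; the common bound
  \<open>max a b\<close> gives the two constructions the same scaling.\<close>

lemma psd_op_intertwine:
  fixes A B :: "'a::{real_inner, banach} \<Rightarrow> 'a"
  assumes A: "psd_op A" and B: "psd_op B" and T: "bounded_linear T"
    and eq: "\<And>x. A (A (T x)) = T (B (B x))"
  shows "A (T x) = T (B x)"
proof -
  obtain a where a: "a > 0" "\<And>x. norm (A x) \<le> a * norm x"
    using bounded_linear_pos_bound[OF psd_opD(1)[OF A]] by blast
  obtain b where b: "b > 0" "\<And>x. norm (B x) \<le> b * norm x"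
    using bounded_linear_pos_bound[OF psd_opD(1)[OF B]] by blast
  have k: "max a b > 0" "norm (A x) \<le> max a b * norm x" "norm (B x) \<le> max a b * norm x" for x
    using a(1) order_trans[OF a(2)] order_trans[OF b(2)] by (simp_all add: mult_right_mono)
  show ?thesis
    by (subst psd_op_eq_scaled_sqrt[OF A k(1,2)], subst psd_op_eq_scaled_sqrt[OF B k(1,3)])
      (rule scaled_sqrt_intertwine[OF k(1) psd_opD(4)[OF A] k(2) psd_opD(4)[OF B] k(3) T eq])
qed

lemma psd_sqrt_unique:
  fixes A B :: "'a::{real_inner, banach} \<Rightarrow> 'a"
  assumes "psd_op A" "psd_op B" "\<And>x. A (A x) = B (B x)"
  shows "A = B"
  using psd_op_intertwine[of A B "\<lambda>x. x"] assms by auto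

subsection \<open>Adjoints and operator absolute values\<close>

text \<open>The representing vector minimizes \<open>\<phi>\<close>: the parallelogram law makes a
  minimizing sequence Cauchy, and the first variation of \<open>\<phi>\<close> at its limit
  vanishes.\<close>

lemma real_riesz:
  fixes f :: "'a::{real_inner, complete_space} \<Rightarrow> real"
  assumes f: "bounded_linear f"
  obtains u where "\<And>x. f x = inner x u"
proof -
  note fL = bounded_linear.linear[OF f]
  define \<phi> where "\<phi> x = inner x x / 2 - f x" for x
  obtain k where k: "k > 0" "\<And>x. norm (f x) \<le> k * norm x"
    using bounded_linear_pos_bound[OF f] by blast
  have lower: "\<phi> x \<ge> - (k\<^sup>2 / 2)" for x
  proof -
    have "f x \<le> k * norm x" using k(2)[of x] by simp
    moreover have "0 \<le> (norm x - k)\<^sup>2" by simp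
    ultimately show ?thesis by (simp add: \<phi>_def dot_square_norm power2_diff field_simps)
  qed
  then have bdd: "bdd_below (range \<phi>)" by (intro bdd_belowI2)
  define m where "m = Inf (range \<phi>)"
  have m: "m \<le> \<phi> x" for x unfolding m_def by (rule cInf_lower[OF _ bdd]) simp
  have "\<exists>x. \<phi> x < m + inverse (real (Suc n))" for n
    using cInf_lessD[of "range \<phi>" "m + inverse (real (Suc n))"] by (auto simp: m_def)
  then obtain X where X: "\<And>n. \<phi> (X n) < m + inverse (real (Suc n))" by metis
  have par: "inner (x - y) (x - y) / 4 = \<phi> x + \<phi> y - 2 * \<phi> ((1/2) *\<^sub>R (x + y))" for x y
    by (simp add: \<phi>_def linear_add[OF fL] linear_scale[OF fL] inner_add_left inner_add_right
        inner_diff_left inner_diff_right inner_commute field_simps)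
  have "Cauchy X"
  proof (rule metric_CauchyI)
    fix e :: real assume e: "e > 0"
    obtain N where N: "inverse (real (Suc N)) < e\<^sup>2 / 8"
      using reals_Archimedean[of "e\<^sup>2 / 8"] e by auto
    have "dist (X i) (X j) < e" if "i \<ge> N" "j \<ge> N" for i j
    proof -
      have "inverse (real (Suc i)) \<le> inverse (real (Suc N))" "inverse (real (Suc j)) \<le> inverse (real (Suc N))"
        using that by (auto simp: field_simps)
      then have "\<phi> (X i) < m + e\<^sup>2 / 8" "\<phi> (X j) < m + e\<^sup>2 / 8" using X[of i] X[of j] N by linarith+
      then have "inner (X i - X j) (X i - X j) / 4 < e\<^sup>2 / 4"
        using m[of "(1/2) *\<^sub>R (X i + X j)"] unfolding par by linarith
      then have "(dist (X i) (X j))\<^sup>2 < e\<^sup>2" by (simp add: dist_norm dot_square_norm)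
      then show ?thesis using e by (simp add: power_less_imp_less_base)
    qed
    then show "\<exists>M. \<forall>i\<ge>M. \<forall>j\<ge>M. dist (X i) (X j) < e" by blast
  qed
  then obtain u where u: "X \<longlonglongrightarrow> u" using Cauchy_convergent convergent_def by blast
  have "(\<lambda>n. \<phi> (X n)) \<longlonglongrightarrow> \<phi> u"
    unfolding \<phi>_def by (intro tendsto_intros u bounded_linear.tendsto[OF f]) simp
  moreover have "(\<lambda>n. m + inverse (real (Suc n))) \<longlonglongrightarrow> m"
    using tendsto_add[OF tendsto_const LIMSEQ_inverse_real_of_nat] by simp
  ultimately have "\<phi> u \<le> m"
    by (rule LIMSEQ_le) (use X less_imp_le in blast)
  then have min: "\<phi> u \<le> \<phi> x" for x using m order_trans by blast
  have "f x = inner x u" for x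
  proof -
    \<comment> \<open>This step changes \<open>\<phi>\<close> by
      \<open>- t^2 (inner x x / 2 + 1)\<close>, so minimality forces \<open>t = 0\<close>; the
      \<open>+ 1\<close> covers \<open>x = 0\<close>.\<close>
    define d t where "d = f x - inner x u" and "t = d / (inner x x + 1)"
    have x: "inner x x + 1 > 0" by (simp add: add_nonneg_pos)
    then have dt: "d = t * (inner x x + 1)" by (simp add: t_def)
    have "\<phi> (u + t *\<^sub>R x) - \<phi> u = t * t * inner x x / 2 - t * d"
      unfolding \<phi>_def d_def linear_add[OF fL] linear_scale[OF fL]
      by (simp add: inner_add_left inner_add_right inner_commute[of u x] algebra_simps add_divide_distrib)
    then have "t * t * (inner x x / 2 + 1) \<le> 0"
      using min[of "u + t *\<^sub>R x"] by (simp add: dt algebra_simps)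
    moreover have "inner x x / 2 + 1 > 0" using x by simp
    ultimately have "t * t \<le> 0" by (simp add: mult_le_0_iff)
    then have "t = 0" by (auto simp: mult_le_0_iff)
    then show ?thesis using dt by (simp add: d_def)
  qed
  then show ?thesis by (rule that)
qed

lemma real_adjoint_exists:
  fixes T :: "'a::{real_inner, complete_space} \<Rightarrow> 'a"
  assumes T: "bounded_linear T"
  obtains U where "adjoint_pair T U"
proof -
  note TL = bounded_linear.linear[OF T]
  obtain k where k: "k > 0" "\<And>x. norm (T x) \<le> k * norm x"
    using bounded_linear_pos_bound[OF T] by blast
  have "\<exists>u. \<forall>x. inner (T x) y = inner x u" for y
    by (rule real_riesz[OF bounded_linear_compose[OF bounded_linear_inner_left[of y] T]])
      (auto simp: o_def)
  then obtain U where U: "\<And>x y. inner (T x) y = inner x (U y)" by metis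
  have "norm (U y) \<le> norm y * k" for y
  proof -
    have "norm (U y) * norm (U y) = inner (T (U y)) y"
      by (simp add: U dot_square_norm power2_eq_square)
    also have "\<dots> \<le> norm (T (U y)) * norm y" by (rule norm_cauchy_schwarz)
    also have "\<dots> \<le> k * norm (U y) * norm y" by (intro mult_right_mono k) simp
    finally show ?thesis using k(1) by (cases "norm (U y) = 0") (auto simp: algebra_simps)
  qed
  then have "bounded_linear U"
    by (intro bounded_linear_intro[where K = k])
      (auto intro!: inner_right_eqI[where ?'a = 'a] simp: inner_add_right U[symmetric])
  then show ?thesis by (intro that[of U]) (simp add: adjoint_pair_def T U)
qed

section \<open>The complex inner product in terms of the real one\<close>

context complex_inner
begin

lemma cinner_add_right: "cinner x (y + z) = cinner x y + cinner x z"
  by (metis cinner_commute cinner_add_left complex_cnj_add)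

lemma cinner_scaleC_right: "cinner x (scaleC a y) = cnj a * cinner x y"
  by (metis cinner_commute cinner_scaleC_left complex_cnj_mult)

lemma cinner_self: "cinner x x = complex_of_real (inner x x)"
proof -
  have "Im (cinner x x) = 0" using cinner_commute[of x x] by (metis Reals_cnj_iff complex_is_Real_iff)
  then show ?thesis by (simp add: inner_eq_Re_cinner complex_eq_iff)
qed

lemma cinner_inner: "cinner x y = Complex (inner x y) (inner x (scaleC \<i> y))"
  by (simp add: inner_eq_Re_cinner cinner_scaleC_right complex_eq_iff)

lemma scaleC_one [simp]: "scaleC 1 x = x"
  using scaleR_scaleC[of 1 x] scaleR_one[of x] by (simp del: scaleR_one)

lemma inner_scaleC_left: "inner (scaleC a x) y = inner x (scaleC (cnj a) y)"
  by (simp add: inner_eq_Re_cinner cinner_scaleC_left cinner_scaleC_right)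

lemma scaleC_scaleR: "scaleC a (scaleR r x) = scaleR r (scaleC a x)"
  by (simp add: scaleR_scaleC scaleC_scaleC mult.commute)

lemma norm_scaleC: "norm (scaleC a x) = cmod a * norm x"
proof -
  have "complex_of_real (inner (scaleC a x) (scaleC a x)) = complex_of_real ((cmod a)\<^sup>2 * inner x x)"
    by (simp add: cinner_self[symmetric] cinner_scaleC_left cinner_scaleC_right
        complex_norm_square del: of_real_power)
  then have "inner (scaleC a x) (scaleC a x) = (cmod a)\<^sup>2 * inner x x"
    by (simp only: of_real_eq_iff)
  then show ?thesis by (simp add: norm_eq_sqrt_inner real_sqrt_mult)
qed

end

lemma bounded_linear_scaleC: "bounded_linear (\<lambda>x::'a::complex_inner. a *\<^sub>C x)"
  by (rule bounded_linear_intro[where K = "cmod a"])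
    (simp_all add: scaleC_add_right scaleC_scaleR norm_scaleC mult.commute)

lemma bounded_clinearD:
  assumes "bounded_clinear T"
  shows "bounded_linear T" "T (c *\<^sub>C x) = c *\<^sub>C T x"
  using assms by (auto simp: bounded_clinear_def)

lemma cadjoint_eqI:
  fixes T :: "'a::chilbert_space \<Rightarrow> 'a"
  assumes "\<And>x y. cinner (T x) y = cinner x (U y)"
  shows "cadjoint T = U"
  unfolding cadjoint_def
proof (rule the_equality)
  fix V assume V: "\<forall>x y. cinner (T x) y = cinner x (V y)"
  have "inner x (V y) = inner x (U y)" for x y
    using V assms by (simp add: inner_eq_Re_cinner)
  then show "V = U" by (metis ext inner_right_eqI)
qed (use assms in blast)

text \<open>Moving \<open>cnj a\<close> across the real pairing makes the adjoint complex-linear.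
  The imaginary part of \<open>cinner x y\<close> is the real product of \<open>x\<close> with
  \<open>\<i> *\<^sub>C y\<close>, so the complex identity follows from the real one.\<close>

lemma adjoint_pair_clinear:
  fixes T :: "'a::complex_inner \<Rightarrow> 'a"
  assumes "bounded_clinear T" "adjoint_pair T U"
  shows "cinner (T x) y = cinner x (U y)" and "bounded_clinear U"
proof -
  have U: "U (a *\<^sub>C y) = a *\<^sub>C U y" for a y
  proof (rule inner_right_eqI)
    fix x
    have "inner x (U (a *\<^sub>C y)) = inner (cnj a *\<^sub>C T x) y"
      by (simp add: adjoint_pairD(3)[OF assms(2), symmetric] inner_scaleC_left)
    also have "\<dots> = inner (cnj a *\<^sub>C x) (U y)"
      by (simp add: adjoint_pairD(3)[OF assms(2), symmetric] bounded_clinearD(2)[OF assms(1)])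
    finally show "inner x (U (a *\<^sub>C y)) = inner x (a *\<^sub>C U y)"
      by (simp add: inner_scaleC_left)
  qed
  then show "cinner (T x) y = cinner x (U y)"
    by (simp add: cinner_inner adjoint_pairD(3)[OF assms(2)] U[symmetric])
  show "bounded_clinear U"
    using U adjoint_pairD(2)[OF assms(2)] by (simp add: bounded_clinear_def)
qed

lemma cadjoint_props:
  fixes T :: "'a::chilbert_space \<Rightarrow> 'a"
  assumes "bounded_clinear T"
  shows adjoint_pair_cadjoint: "adjoint_pair T (cadjoint T)"
    and bounded_clinear_cadjoint: "bounded_clinear (cadjoint T)"
proof -
  obtain U where U: "adjoint_pair T U" using real_adjoint_exists bounded_clinearD(1)[OF assms] by blast
  moreover have "cadjoint T = U" by (rule cadjoint_eqI) (rule adjoint_pair_clinear(1)[OF assms U])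
  ultimately show "adjoint_pair T (cadjoint T)" "bounded_clinear (cadjoint T)"
    using adjoint_pair_clinear(2)[OF assms] by simp_all
qed

lemma cadjoint_eq_adjoint_pair:
  assumes "bounded_clinear T" "adjoint_pair T U"
  shows "cadjoint T = U"
  by (rule cadjoint_eqI) (rule adjoint_pair_clinear(1)[OF assms])

text \<open>Polarization: the sesquilinear \<open>q\<close> vanishes on the diagonal, so
  \<open>q x y = - q y x\<close>, and with \<open>\<i> *\<^sub>C y\<close> for \<open>y\<close> also
  \<open>q x y = q y x\<close>. This yields the symmetry required by \<open>psd_op\<close>.\<close>

lemma positive_op_iff_psd: "positive_op A \<longleftrightarrow> bounded_clinear A \<and> psd_op A"
proof
  assume "positive_op A"
  then have A: "bounded_clinear A" and pos: "\<And>x. cinner (A x) x \<in> \<real>\<^sub>\<ge>\<^sub>0"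
    by (auto simp: positive_op_def)
  note AL = bounded_clinearD(1)[OF A, THEN bounded_linear.linear]
  define q where "q x y = cinner (A x) y - cinner x (A y)" for x y
  have qq: "q x x = 0" for x
  proof -
    have "cnj (cinner (A x) x) = cinner (A x) x" using pos[of x] by (auto elim!: nonneg_Reals_cases)
    then show ?thesis by (metis cinner_commute q_def right_minus_eq)
  qed
  have add: "q x y + q y x = 0" for x y
    using qq[of "x + y"] qq[of x] qq[of y]
    by (simp add: q_def linear_add[OF AL] cinner_add_left cinner_add_right algebra_simps)
  have "q x y = 0" for x y
  proof -
    have "q x (\<i> *\<^sub>C y) = - \<i> * q x y" "q (\<i> *\<^sub>C y) x = \<i> * q y x"
      by (simp_all add: q_def bounded_clinearD(2)[OF A] cinner_scaleC_left cinner_scaleC_right algebra_simps)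
    then have "\<i> * (q y x - q x y) = 0" using add[of x "\<i> *\<^sub>C y"] by (simp add: algebra_simps)
    then show ?thesis using add[of x y] by simp
  qed
  then have "inner (A x) y = inner x (A y)" for x y by (simp add: q_def inner_eq_Re_cinner)
  moreover have "0 \<le> inner (A x) x" for x
    using pos[of x] by (auto simp: inner_eq_Re_cinner elim!: nonneg_Reals_cases)
  ultimately show "bounded_clinear A \<and> psd_op A"
    using A by (simp add: psd_op_def adjoint_pair_def bounded_clinearD(1))
next
  assume A: "bounded_clinear A \<and> psd_op A"
  then have "cinner (A x) x = cinner x (A x)" for x
    using adjoint_pair_clinear(1) psd_opD(4) by blast
  then have "cinner (A x) x = complex_of_real (inner (A x) x)" for x
    by (metis Reals_cnj_iff cinner_commute inner_eq_Re_cinner of_real_Re)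
  then show "positive_op A" using A by (simp add: positive_op_def psd_opD(3))
qed

lemma op_abs_unique_psd_sqrt:
  fixes T :: "'a::chilbert_space \<Rightarrow> 'a"
  assumes T: "bounded_clinear T"
  shows bounded_clinear_op_abs: "bounded_clinear (op_abs T)"
    and psd_op_op_abs: "psd_op (op_abs T)"
    and op_abs_square: "op_abs T (op_abs T x) = cadjoint T (T x)"
    and op_abs_eqI: "\<And>R. bounded_clinear R \<Longrightarrow> psd_op R \<Longrightarrow> (\<And>x. R (R x) = cadjoint T (T x)) \<Longrightarrow> op_abs T = R"
proof -
  note adj = adjoint_pair_cadjoint[OF T]
  note U = bounded_clinear_cadjoint[OF T]
  obtain k where k: "k > 0" "\<And>x. norm (T x) \<le> k * norm x"
    using bounded_linear_pos_bound[OF bounded_clinearD(1)[OF T]] by blast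
  define R where "R = scaled_sqrt k (\<lambda>x. cadjoint T (T x))"
  have R: "psd_op R" unfolding R_def by (rule scaled_sqrt_psd[OF adj k])
  \<comment> \<open>Multiplication by \<open>a\<close> is real-linear and commutes with
    \<open>T\<close> and its adjoint, so the root built over the reals commutes with it too.\<close>
  have RC: "R (a *\<^sub>C x) = a *\<^sub>C R x" for a x
    unfolding R_def by (rule scaled_sqrt_intertwine[OF k(1) adj k(2) adj k(2) bounded_linear_scaleC])
      (simp add: bounded_clinearD(2)[OF T] bounded_clinearD(2)[OF U])
  have RR: "R (R x) = cadjoint T (T x)" for x
    unfolding R_def by (rule scaled_sqrt_square[OF adj k])
  have Rcl: "bounded_clinear R" using RC psd_opD(1)[OF R] by (simp add: bounded_clinear_def)
  have uniq: "op_abs T = Q" if Q: "bounded_clinear Q" "psd_op Q" "\<And>x. Q (Q x) = cadjoint T (T x)" for Q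
    unfolding op_abs_def op_sqrt_def
  proof (rule the_equality)
    show "positive_op Q \<and> Q \<circ> Q = cadjoint T \<circ> T"
      using Q by (auto simp: positive_op_iff_psd)
    fix V assume "positive_op V \<and> V \<circ> V = cadjoint T \<circ> T"
    then show "V = Q" using Q by (intro psd_sqrt_unique) (auto simp: positive_op_iff_psd fun_eq_iff)
  qed
  have "op_abs T = R" using uniq Rcl R RR by blast
  then show "bounded_clinear (op_abs T)" "psd_op (op_abs T)" "op_abs T (op_abs T x) = cadjoint T (T x)"
    using Rcl R RR by auto
  show "\<And>R. bounded_clinear R \<Longrightarrow> psd_op R \<Longrightarrow> (\<And>x. R (R x) = cadjoint T (T x)) \<Longrightarrow> op_abs T = R"
    by (rule uniq)
qed

subsection \<open>Operators that are small near every point of a spectrum\<close>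

text \<open>Swapping index and exponent gives a geometric series in \<open>k\<close> with ratio
  \<open>r i * cnj (r j)\<close>, an \<open>n\<close>-th root of unity equal to 1 only for
  \<open>i = j\<close>.\<close>

lemma roots_of_unity_orthogonal:
  fixes i j n :: nat
  assumes "i < n" "j < n"
  shows "(\<Sum>k<n. cis (2 * pi * real k / real n) ^ i * cnj (cis (2 * pi * real k / real n)) ^ j)
      = (if i = j then of_nat n else 0)"
proof -
  define r where "r l = cis (2 * pi * real l / real n)" for l
  have n: "n > 0" using assms by simp
  have bij: "bij_betw r {..<n} {z. z ^ n = 1}"
    unfolding r_def using Complex.bij_betw_roots_unity[OF n] .
  have norm1: "r l * cnj (r l) = 1" for l
    by (simp add: r_def complex_norm_square[symmetric])
  have powers: "r k ^ i * cnj (r k) ^ j = (r i * cnj (r j)) ^ k" for k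
  proof -
    have "r k ^ l = r l ^ k" for l by (simp add: r_def Complex.DeMoivre mult_ac)
    then show ?thesis by (simp add: power_mult_distrib flip: complex_cnj_power)
  qed
  show ?thesis
  proof (cases "i = j")
    case True
    then show ?thesis by (simp add: norm1 flip: r_def power_mult_distrib)
  next
    case False
    have "r i * cnj (r j) \<noteq> 1"
    proof
      assume "r i * cnj (r j) = 1"
      then have "r i = r j" using norm1[of j]
        by (metis mult.commute mult.left_commute mult.right_neutral)
      then show False using bij assms False by (auto simp: bij_betw_def inj_on_def)
    qed
    moreover have "r l ^ n = 1" if "l < n" for l
      using bij that by (auto simp: bij_betw_def)
    then have "(r i * cnj (r j)) ^ n = 1"
      using assms by (simp add: power_mult_distrib flip: complex_cnj_power)
    ultimately show ?thesis
      using False by (simp add: powers geometric_sum flip: r_def)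
  qed
qed

lemma scaleC_zero_left [simp]: "0 *\<^sub>C (x::'a::complex_inner) = 0"
  using scaleR_scaleC[of 0 x] by simp

lemma scaleC_minus_left: "(- a) *\<^sub>C x = - (a *\<^sub>C (x::'a::complex_inner))"
  using scaleC_add_left[of a "- a" x] by (simp add: eq_neg_iff_add_eq_0 add.commute)

lemma scaleC_diff_right: "a *\<^sub>C (x - y) = a *\<^sub>C x - a *\<^sub>C (y::'a::complex_inner)"
  by (rule linear_diff[OF bounded_linear.linear[OF bounded_linear_scaleC]])

lemma scaleC_sum_left: "(\<Sum>k\<in>I. c k) *\<^sub>C (x::'a::complex_inner) = (\<Sum>k\<in>I. c k *\<^sub>C x)"
  by (induction I rule: infinite_finite_induct) (simp_all add: scaleC_add_left)

lemma scaleC_sum_right: "a *\<^sub>C (\<Sum>k\<in>I. f k) = (\<Sum>k\<in>I. a *\<^sub>C (f k :: 'a::complex_inner))"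
  by (rule linear_sum[OF bounded_linear.linear[OF bounded_linear_scaleC]])

lemma bounded_clinear_funpow:
  fixes T :: "'a::complex_inner \<Rightarrow> 'a"
  assumes "bounded_clinear T"
  shows "bounded_clinear (T ^^ n)"
proof (induction n)
  case (Suc n)
  show ?case
    using bounded_linear_compose[OF bounded_clinearD(1)[OF assms] bounded_clinearD(1)[OF Suc.IH]]
      bounded_clinearD(2)[OF assms] bounded_clinearD(2)[OF Suc]
    by (simp add: bounded_clinear_def o_def)
qed (simp add: bounded_clinear_def id_def)

lemma adjoint_pair_compose:
  assumes "adjoint_pair T U" "adjoint_pair T' U'"
  shows "adjoint_pair (T \<circ> T') (U' \<circ> U)"
  using assms unfolding adjoint_pair_def o_def by (auto intro: bounded_linear_compose)

lemma adjoint_pair_funpow: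
  assumes "adjoint_pair T U"
  shows "adjoint_pair (T ^^ n) (U ^^ n)"
proof (induction n)
  case (Suc n)
  show ?case using adjoint_pair_compose[OF assms Suc] unfolding funpow.simps(2)[of n T] funpow_Suc_right[of n U] .
qed (simp add: adjoint_pair_def id_def)

text \<open>
  The vectors \<open>u k\<close> are \<open>n\<close> times the components of \<open>y\<close> with respect to the approximate spectral
  decomposition of \<open>W\<close> along the \<open>n\<close>-th roots of unity, and \<open>q k\<close> is adjoint to \<open>y \<mapsto> u k\<close>.
  The hypothesis bounds \<open>K (q k z)\<close> independently of \<open>n\<close>, because \<open>\<omega> V - 1\<close> telescopes the sum
  \<open>q k z\<close>.
\<close>

lemma unitary_local_bound_zero:
  fixes V W K :: "'a::chilbert_space \<Rightarrow> 'a"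
  assumes W: "bounded_clinear W" and V: "bounded_clinear V" and adj: "adjoint_pair W V"
    and VW: "\<And>x. V (W x) = x" and WV: "\<And>x. W (V x) = x"
    and K: "bounded_linear K" and C: "C \<ge> 0"
    and bound: "\<And>\<omega> z. cmod \<omega> = 1 \<Longrightarrow> norm (K z) \<le> C * norm (\<omega> *\<^sub>C V z - z)"
  shows "K y = 0"
proof -
  note KL = bounded_linear.linear[OF K]
  have normV: "norm ((V ^^ n) z) = norm z" for n z
  proof (induction n)
    case (Suc n)
    have "inner (V x) (V x) = inner x x" for x
      using adjoint_pairD(3)[OF adj, of "V x" x] by (simp add: WV)
    then show ?case using Suc by (simp add: norm_eq_sqrt_inner)
  qed simp
  have VWn: "(V ^^ n) ((W ^^ n) z) = z" for n z
  proof (induction n)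
    case (Suc n)
    then show ?case by (simp add: funpow_swap1[of V] VW)
  qed simp
  note Vn = bounded_clinear_funpow[OF V]
  have main: "real n * (norm (K y))\<^sup>2 \<le> 4 * C\<^sup>2 * (norm y)\<^sup>2" if n: "n > 0" for n
  proof -
    define \<omega> where "\<omega> k = cis (2 * pi * real k / real n)" for k
    define q where "q k z = (\<Sum>i<n. \<omega> k ^ i *\<^sub>C (V ^^ i) z)" for k z
    define u where "u k = (\<Sum>j<n. cnj (\<omega> k) ^ j *\<^sub>C (W ^^ j) y)" for k
    have qadj: "inner (u k) z = inner y (q k z)" for k z
      by (simp add: u_def q_def inner_sum_left inner_sum_right inner_scaleC_left
          adjoint_pairD(3)[OF adjoint_pair_funpow[OF adj]] bounded_clinearD(2)[OF Vn] flip: complex_cnj_power)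
    have Kq: "norm (K (q k z)) \<le> 2 * C * norm z" for k z
    proof -
      have cm: "cmod (\<omega> k) = 1" by (simp add: \<omega>_def)
      have "\<omega> k *\<^sub>C V (q k z) = (\<Sum>i<n. \<omega> k ^ Suc i *\<^sub>C (V ^^ Suc i) z)"
        by (simp add: q_def linear_sum[OF bounded_linear.linear[OF bounded_clinearD(1)[OF V]]]
            scaleC_sum_right bounded_clinearD(2)[OF V] scaleC_scaleC)
      then have "\<omega> k *\<^sub>C V (q k z) - q k z
          = (\<Sum>i<n. \<omega> k ^ Suc i *\<^sub>C (V ^^ Suc i) z - \<omega> k ^ i *\<^sub>C (V ^^ i) z)"
        by (simp only: q_def sum_subtractf)
      also have "\<dots> = \<omega> k ^ n *\<^sub>C (V ^^ n) z - z"
        by (subst sum_lessThan_telescope) simp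
      finally have "norm (\<omega> k *\<^sub>C V (q k z) - q k z) \<le> norm (\<omega> k ^ n *\<^sub>C (V ^^ n) z) + norm z"
        by (simp add: norm_triangle_ineq4)
      then have "norm (\<omega> k *\<^sub>C V (q k z) - q k z) \<le> 2 * norm z"
        by (simp add: norm_scaleC norm_power cm normV)
      then have "C * norm (\<omega> k *\<^sub>C V (q k z) - q k z) \<le> C * (2 * norm z)"
        by (rule mult_left_mono) (rule C)
      then show ?thesis using bound[OF cm, of "q k z"] by simp
    qed
    \<comment> \<open>Orthogonality leaves the \<open>n\<close> diagonal terms
      \<open>V^i W^i y = y\<close>, each with weight \<open>n\<close>.\<close>
    have qu: "(\<Sum>k<n. q k (u k)) = (real n * real n) *\<^sub>R y"
    proof -
      have "q k (u k) = (\<Sum>i<n. \<Sum>j<n. (\<omega> k ^ i * cnj (\<omega> k) ^ j) *\<^sub>C (V ^^ i) ((W ^^ j) y))" for k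
        by (simp add: q_def u_def linear_sum[OF bounded_linear.linear[OF bounded_clinearD(1)[OF Vn]]]
            scaleC_sum_right bounded_clinearD(2)[OF Vn] scaleC_scaleC)
      then have "(\<Sum>k<n. q k (u k))
          = (\<Sum>k<n. \<Sum>i<n. \<Sum>j<n. (\<omega> k ^ i * cnj (\<omega> k) ^ j) *\<^sub>C (V ^^ i) ((W ^^ j) y))"
        by simp
      also have "\<dots> = (\<Sum>i<n. \<Sum>k<n. \<Sum>j<n. (\<omega> k ^ i * cnj (\<omega> k) ^ j) *\<^sub>C (V ^^ i) ((W ^^ j) y))"
        by (rule sum.swap)
      also have "\<dots> = (\<Sum>i<n. \<Sum>j<n. (\<Sum>k<n. \<omega> k ^ i * cnj (\<omega> k) ^ j) *\<^sub>C (V ^^ i) ((W ^^ j) y))"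
        unfolding scaleC_sum_left by (intro sum.cong refl sum.swap)
      also have "\<dots> = (\<Sum>i<n. \<Sum>j<n. if i = j then real n *\<^sub>R y else 0)"
        by (intro sum.cong refl) (simp add: \<omega>_def roots_of_unity_orthogonal VWn scaleR_scaleC)
      also have "\<dots> = (real n * real n) *\<^sub>R y"
        by (simp add: sum_constant_scaleR)
      finally show ?thesis .
    qed
    have "(\<Sum>k<n. (norm (u k))\<^sup>2) = (\<Sum>k<n. inner y (q k (u k)))"
      by (simp add: qadj[symmetric] dot_square_norm)
    also have "\<dots> = (real n * real n) * (norm y)\<^sup>2"
      by (simp add: qu dot_square_norm flip: inner_sum_right)
    finally have parseval: "(\<Sum>k<n. (norm (u k))\<^sup>2) = (real n * real n) * (norm y)\<^sup>2" .
    \<comment> \<open>The left side has the factor \<open>n^2\<close>, whereas Cauchy-Schwarz and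
      \<open>parseval\<close> bound the sum of the \<open>norm (u k)\<close> by
      \<open>n powr (3/2) * norm y\<close>. The missing power of \<open>n\<close> forces
      \<open>K y = 0\<close>.\<close>
    have "(real n * real n) * norm (K y) = norm (\<Sum>k<n. K (q k (u k)))"
      by (simp add: linear_sum[OF KL, symmetric] qu linear_scale[OF KL])
    also have "\<dots> \<le> 2 * C * (\<Sum>k<n. norm (u k))"
      unfolding sum_distrib_left by (rule sum_norm_le) (rule Kq)
    finally have "((real n * real n) * norm (K y))\<^sup>2 \<le> (2 * C * (\<Sum>k<n. norm (u k)))\<^sup>2"
      by (rule power_mono) simp
    also have "\<dots> = 4 * C\<^sup>2 * (\<Sum>k<n. norm (u k))\<^sup>2"
      by (simp add: power_mult_distrib)
    also have "\<dots> \<le> 4 * C\<^sup>2 * ((real n * real n * (norm y)\<^sup>2) * real n)"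
      using sum_squared_le_sum_of_squares[of "\<lambda>k. norm (u k)" "{..<n}"]
      by (intro mult_left_mono) (simp_all add: parseval)
    finally have "(real n ^ 3) * (real n * (norm (K y))\<^sup>2) \<le> (real n ^ 3) * (4 * C\<^sup>2 * (norm y)\<^sup>2)"
      by (simp add: power2_eq_square power3_eq_cube algebra_simps)
    then show ?thesis using n by simp
  qed
  show ?thesis
  proof (rule ccontr)
    assume "K y \<noteq> 0"
    then have "(norm (K y))\<^sup>2 > 0" by simp
    then obtain n where n: "4 * C\<^sup>2 * (norm y)\<^sup>2 < real n * (norm (K y))\<^sup>2"
      using reals_Archimedean3 by blast
    have "0 \<le> 4 * C\<^sup>2 * (norm y)\<^sup>2" by simp
    with n have "n > 0" by (intro gr0I) (auto simp: not_less[symmetric])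
    with n show False using main[of n] by simp
  qed
qed

text \<open>With \<open>M = N / k\<close>, \<open>s = sqrt (1 - M^2)\<close> and
  \<open>\<omega> = a + \<i> b\<close> on the unit circle, \<open>V - cnj \<omega>\<close> is
  \<open>(M - a) - \<i> (s - b)\<close>. Its two parts have orthogonal values at each vector, so
  closeness of \<open>V\<close> to \<open>cnj \<omega>\<close> implies closeness of \<open>N\<close>
  to \<open>l = k a\<close>.\<close>

lemma symmetric_local_bound_zero:
  fixes N K :: "'a::chilbert_space \<Rightarrow> 'a"
  assumes N: "bounded_clinear N" and sym: "adjoint_pair N N"
    and k: "k > 0" "\<And>x. norm (N x) \<le> k * norm x"
    and K: "bounded_linear K" and C: "C \<ge> 0"
    and bound: "\<And>l z. \<bar>l\<bar> \<le> k \<Longrightarrow> norm (K z) \<le> C * norm (N z - l *\<^sub>R z)"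
  shows "K y = 0"
proof -
  define M where "M x = (1 / k) *\<^sub>R N x" for x
  have M: "bounded_linear M" "adjoint_pair M M" "M (a *\<^sub>C x) = a *\<^sub>C M x" for a x
    using sym bounded_clinearD[OF N]
    by (auto simp: M_def[abs_def] adjoint_pair_def scaleC_scaleR intro: bounded_linear_const_scaleR)
  note linM = bounded_linear.linear[OF M(1)]
  have normM: "norm (M x) \<le> norm x" for x
    using k(1) k(2)[of x] by (simp add: M_def field_simps)
  define D where "D = Blinfun (\<lambda>x. M (M x))"
  have D: "D x = M (M x)" for x
    unfolding D_def by (simp add: bounded_linear_Blinfun_apply bounded_linear_compose[OF M(1) M(1)])
  have nD: "norm D \<le> 1"
    by (rule norm_blinfun_bound) (auto simp: D intro: order_trans[OF normM normM])
  define s where "s = blinfun_apply (sqrt_compl D)"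
  have s: "psd_op s" unfolding s_def
    by (rule sqrt_compl_psd[OF nD]) (simp add: D adjoint_pairD(3)[OF M(2)])
  have ss: "s (s x) = x - M (M x)" for x
    using sqrt_compl_square[OF nD] by (simp add: s_def D)
  have sM: "s (M x) = M (s x)" for x
    unfolding s_def by (rule sqrt_compl_intertwine[OF nD nD M(1)]) (simp add: D)
  have sC: "s (a *\<^sub>C x) = a *\<^sub>C s x" for a x
    unfolding s_def by (rule sqrt_compl_intertwine[OF nD nD bounded_linear_scaleC]) (simp add: D M(3))
  note linS = bounded_linear.linear[OF psd_opD(1)[OF s]]
  define W where "W x = M x + \<i> *\<^sub>C s x" for x
  define V where "V x = M x + (- \<i>) *\<^sub>C s x" for x
  have WV: "W (V x) = x" "V (W x) = x" for x
    by (simp_all add: W_def V_def linear_add[OF linM] linear_add[OF linS]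
        linear_diff[OF linM] linear_diff[OF linS] M(3) sC sM ss scaleC_add_right scaleC_scaleC
        scaleC_diff_right scaleC_minus_left)
  have bl: "bounded_linear W" "bounded_linear V"
    unfolding W_def[abs_def] V_def[abs_def]
    by (intro bounded_linear_add M(1) bounded_linear_compose[OF bounded_linear_scaleC psd_opD(1)[OF s]])+
  have cl: "bounded_clinear W" "bounded_clinear V"
    using bl by (auto simp: bounded_clinear_def W_def V_def M(3) sC scaleC_add_right scaleC_scaleC mult.commute)
  have adj: "adjoint_pair W V"
    using bl by (auto simp: adjoint_pair_def W_def V_def inner_add_left inner_add_right
      adjoint_pairD(3)[OF M(2)] inner_scaleC_left psd_opD(2)[OF s] sC)
  have "norm (K z) \<le> (C * k) * norm (\<omega> *\<^sub>C V z - z)" if \<omega>: "cmod \<omega> = 1" for \<omega> z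
  proof -
    define a b where "a = Re \<omega>" and "b = Im \<omega>"
    define p r where "p x = M x - a *\<^sub>R x" and "r x = s x - b *\<^sub>R x" for x
    have p: "inner (p x) y = inner x (p y)" "p (c *\<^sub>C x) = c *\<^sub>C p x"
      and r: "inner (r x) y = inner x (r y)" "r (c *\<^sub>C x) = c *\<^sub>C r x"
      and pr: "p (r x) = r (p x)" for x y c
      by (simp_all add: p_def r_def inner_diff_left inner_diff_right adjoint_pairD(3)[OF M(2)] psd_opD(2)[OF s]
         M(3) sC sM linear_diff[OF linM] linear_diff[OF linS] linear_scale[OF linM] linear_scale[OF linS]
         scaleC_diff_right scaleC_scaleR algebra_simps)
    \<comment> \<open>As \<open>p\<close> and \<open>r\<close> are symmetric, complex-linear and
      commute, \<open>\<i> p r\<close> is skew and the real cross term vanishes.\<close>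
    have "inner (p z) (\<i> *\<^sub>C r z) = inner z (\<i> *\<^sub>C r (p z))"
      by (simp add: p pr)
    also have "\<dots> = inner (r ((- \<i>) *\<^sub>C z)) (p z)"
      by (simp add: r(1) inner_scaleC_left)
    also have "\<dots> = - inner (p z) (\<i> *\<^sub>C r z)"
      unfolding r(2) by (simp add: scaleC_minus_left inner_commute)
    finally have cross: "inner (p z) (\<i> *\<^sub>C r z) = 0" by simp
    have \<omega>\<omega>: "\<omega> * cnj \<omega> = 1" using \<omega> by (simp add: complex_norm_square[symmetric])
    have "cnj \<omega> = complex_of_real a + (- \<i>) * complex_of_real b"
      by (simp add: a_def b_def complex_eq_iff)
    then have "cnj \<omega> *\<^sub>C z = a *\<^sub>R z + (- \<i>) *\<^sub>C (b *\<^sub>R z)"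
      by (simp only: scaleC_add_left scaleR_scaleC scaleC_scaleC)
    then have "V z - cnj \<omega> *\<^sub>C z = p z - \<i> *\<^sub>C r z"
      by (simp add: V_def p_def r_def scaleC_minus_left scaleC_diff_right)
    moreover have "\<omega> *\<^sub>C V z - z = \<omega> *\<^sub>C (V z - cnj \<omega> *\<^sub>C z)"
      by (simp add: scaleC_diff_right scaleC_scaleC \<omega>\<omega>)
    ultimately have "norm (\<omega> *\<^sub>C V z - z) = norm (p z - \<i> *\<^sub>C r z)"
      by (simp add: norm_scaleC \<omega>)
    moreover
    have "(norm (p z))\<^sup>2 \<le> (norm (p z - \<i> *\<^sub>C r z))\<^sup>2"
      using cross inner_commute[of "p z" "\<i> *\<^sub>C r z"]
      by (simp add: power2_norm_eq_inner inner_diff_left inner_diff_right)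
    then have "norm (p z) \<le> norm (p z - \<i> *\<^sub>C r z)"
      by (rule power2_le_imp_le) simp
    ultimately have le: "norm (p z) \<le> norm (\<omega> *\<^sub>C V z - z)"
      by simp
    have "\<bar>k * a\<bar> \<le> k"
      using abs_Re_le_cmod[of \<omega>] k(1) \<omega> by (simp add: abs_mult a_def)
    then have "norm (K z) \<le> C * norm (N z - (k * a) *\<^sub>R z)" by (rule bound)
    also have "N z - (k * a) *\<^sub>R z = k *\<^sub>R p z"
      using k(1) by (simp add: p_def M_def scaleR_diff_right)
    also have "C * norm (k *\<^sub>R p z) = (C * k) * norm (p z)" using k(1) by simp
    also have "\<dots> \<le> (C * k) * norm (\<omega> *\<^sub>C V z - z)"
      using C k(1) by (intro mult_left_mono le) simp
    finally show ?thesis .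
  qed
  moreover have "0 \<le> C * k" using C k(1) by simp
  ultimately show ?thesis
    using unitary_local_bound_zero[OF cl adj WV(2) WV(1) K] by blast
qed

subsection \<open>Paranormal operators\<close>

lemma paranormal_pair_estimate:
  fixes S U N :: "'a::real_inner \<Rightarrow> 'a"
  assumes adj: "adjoint_pair S U" and sym: "adjoint_pair N N"
    and NN: "\<And>x. N (N x) = U (U (S (S x)))"
    and S: "\<And>x. (norm (S x))\<^sup>2 \<le> norm x * norm (S (S x))"
    and U: "\<And>x. (norm (U x))\<^sup>2 \<le> norm x * norm (U (U x))"
    and l: "l > 0"
  shows "2 * l * (norm (U (S (S x)) - l *\<^sub>R S x))\<^sup>2 \<le> (norm (N (N x) - l\<^sup>2 *\<^sub>R x))\<^sup>2"
proof -
  \<comment> \<open>The mean inequality for \<open>d\<close> and \<open>l * a\<close> makes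
    paranormality quadratic, so that it can be compared with expanded squared norms.\<close>
  have amgm: "2 * l * b \<le> d\<^sup>2 + l\<^sup>2 * a\<^sup>2" if "b \<le> a * d" for a b d :: real
  proof -
    have "2 * l * b \<le> 2 * l * (a * d)" using l that by (intro mult_left_mono) simp_all
    moreover have "0 \<le> (d - l * a)\<^sup>2" by simp
    ultimately show ?thesis by (simp add: power2_diff power_mult_distrib algebra_simps)
  qed
  have 1: "2 * l * (norm (S x))\<^sup>2 \<le> (norm (S (S x)))\<^sup>2 + l\<^sup>2 * (norm x)\<^sup>2"
    by (rule amgm[OF S])
  have 2: "2 * l * (norm (U (S (S x))))\<^sup>2 \<le> (norm (N (N x)))\<^sup>2 + l\<^sup>2 * (norm (S (S x)))\<^sup>2"
    unfolding NN by (rule amgm[OF U])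
  have eq1: "inner (U (S (S x))) (S x) = (norm (S (S x)))\<^sup>2"
    by (metis adj adjoint_pairD(3) adjoint_pair_flip dot_square_norm)
  have eq2: "inner (N (N x)) x = (norm (S (S x)))\<^sup>2"
    unfolding NN by (metis adj adjoint_pairD(3) adjoint_pair_flip dot_square_norm)
  have "2 * l * (norm (U (S (S x)) - l *\<^sub>R S x))\<^sup>2
      = 2 * l * (norm (U (S (S x))))\<^sup>2 - 4 * l\<^sup>2 * (norm (S (S x)))\<^sup>2 + l\<^sup>2 * (2 * l * (norm (S x))\<^sup>2)"
    using eq1 inner_commute[of "S x" "U (S (S x))"]
    by (simp add: power2_norm_eq_inner inner_diff_left inner_diff_right power2_eq_square[of l] algebra_simps)
  also have "\<dots> \<le> ((norm (N (N x)))\<^sup>2 + l\<^sup>2 * (norm (S (S x)))\<^sup>2) - 4 * l\<^sup>2 * (norm (S (S x)))\<^sup>2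
      + l\<^sup>2 * ((norm (S (S x)))\<^sup>2 + l\<^sup>2 * (norm x)\<^sup>2)"
    by (intro add_mono diff_mono 2 mult_left_mono 1) simp_all
  also have "\<dots> = (norm (N (N x)))\<^sup>2 - 2 * l\<^sup>2 * (norm (S (S x)))\<^sup>2 + l\<^sup>2 * l\<^sup>2 * (norm x)\<^sup>2"
    by (simp add: algebra_simps)
  also have "\<dots> = (norm (N (N x) - l\<^sup>2 *\<^sub>R x))\<^sup>2"
    using eq2 inner_commute[of x "N (N x)"]
    by (simp add: power2_norm_eq_inner inner_diff_left inner_diff_right algebra_simps)
  finally show ?thesis .
qed

text \<open>
  The operator \<open>K = S\<^sup>*S S - S N\<close> satisfies a bound of the required kind only up to a factor of
  order \<open>l powr (-1/2)\<close>. Multiplying by \<open>N\<close>, which is close to \<open>l\<close> where \<open>N - l\<close> is small,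
  absorbs this factor.
\<close>

lemma paranormal_pair_abs_eq:
  fixes S U N :: "'a::chilbert_space \<Rightarrow> 'a"
  assumes adj: "adjoint_pair S U" and N: "bounded_clinear N" and psd: "psd_op N"
    and NN: "\<And>x. N (N x) = U (U (S (S x)))"
    and S: "\<And>x. (norm (S x))\<^sup>2 \<le> norm x * norm (S (S x))"
    and U: "\<And>x. (norm (U x))\<^sup>2 \<le> norm x * norm (U (U x))"
  shows "N x = U (S x)"
proof -
  note sym = psd_opD(4)[OF psd]
  note blS = adjoint_pairD(1)[OF adj] and blU = adjoint_pairD(2)[OF adj] and blN = bounded_clinearD(1)[OF N]
  note linS = bounded_linear.linear[OF blS] and linU = bounded_linear.linear[OF blU]
    and linN = bounded_linear.linear[OF blN]
  obtain k where k: "k > 0" "\<And>x. norm (N x) \<le> k * norm x"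
    using bounded_linear_pos_bound[OF blN] by blast
  obtain c where c: "c > 0" "\<And>x. norm (S x) \<le> c * norm x"
    using bounded_linear_pos_bound[OF blS] by blast
  define K where "K x = U (S (S x)) - S (N x)" for x
  have K: "bounded_linear K"
    unfolding K_def[abs_def]
    by (intro bounded_linear_sub bounded_linear_compose[OF blU] bounded_linear_compose[OF blS] blS blN)
  note linK = bounded_linear.linear[OF K]
  obtain d where d: "d > 0" "\<And>x. norm (K x) \<le> d * norm x"
    using bounded_linear_pos_bound[OF K] by blast
  have Kl: "l * norm (K z) \<le> (2 * k * sqrt k + k * c) * norm (N z - l *\<^sub>R z)" if l: "0 < l" "l \<le> k" for l z
  proof -
    define w where "w = N z - l *\<^sub>R z"
    \<comment> \<open>This is the factorization \<open>N^2 - l^2 = (N + l) (N - l)\<close>.\<close>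
    have "N (N z) - l\<^sup>2 *\<^sub>R z = N w + l *\<^sub>R w"
      by (simp add: w_def linear_diff[OF linN] linear_scale[OF linN] scaleR_diff_right power2_eq_square)
    then have "norm (N (N z) - l\<^sup>2 *\<^sub>R z) \<le> norm (N w) + norm (l *\<^sub>R w)"
      using norm_triangle_ineq by metis
    also have "\<dots> \<le> k * norm w + k * norm w"
      using k(2)[of w] l by (intro add_mono) (simp_all add: mult_right_mono)
    finally have 1: "norm (N (N z) - l\<^sup>2 *\<^sub>R z) \<le> 2 * k * norm w" by simp
    define v where "v = U (S (S z)) - l *\<^sub>R S z"
    have "(l * norm v)\<^sup>2 = (l / 2) * (2 * l * (norm v)\<^sup>2)"
      by (simp add: power2_eq_square)
    also have "\<dots> \<le> (l / 2) * (norm (N (N z) - l\<^sup>2 *\<^sub>R z))\<^sup>2"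
      unfolding v_def using l by (intro mult_left_mono paranormal_pair_estimate[OF adj sym NN S U]) simp_all
    also have "\<dots> \<le> k * (2 * k * norm w)\<^sup>2"
      using l by (intro mult_mono power_mono 1) simp_all
    also have "\<dots> = (2 * k * sqrt k * norm w)\<^sup>2"
      using k(1) by (simp add: power_mult_distrib)
    finally have v: "l * norm v \<le> 2 * k * sqrt k * norm w"
      by (rule power2_le_imp_le) (use k(1) in simp)
    have "K z = v - S w"
      by (simp add: K_def v_def w_def linear_diff[OF linS] linear_scale[OF linS])
    then have "l * norm (K z) \<le> l * (norm v + norm (S w))"
      using l by (intro mult_left_mono) (simp_all add: norm_triangle_ineq4)
    also have "\<dots> \<le> 2 * k * sqrt k * norm w + k * (c * norm w)"
      unfolding distrib_left using l c(1) by (intro add_mono v mult_mono c(2)) simp_all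
    finally show ?thesis by (simp add: w_def algebra_simps)
  qed
  have "K (N y) = 0" for y
  proof (rule symmetric_local_bound_zero[OF N sym k bounded_linear_compose[OF K blN]])
    \<comment> \<open>The extra \<open>d\<close> pays for \<open>K w\<close> when \<open>l\<close>
      is positive and for all of \<open>K (N z)\<close> otherwise.\<close>
    define C where "C = 2 * k * sqrt k + k * c + d"
    show "0 \<le> C" using k c d by (simp add: C_def)
    fix l :: real and z assume "\<bar>l\<bar> \<le> k"
    define w where "w = N z - l *\<^sub>R z"
    show "norm (K (N z)) \<le> C * norm (N z - l *\<^sub>R z)"
    proof (cases "l > 0")
      case True
      have "K (N z) = l *\<^sub>R K z + K w"
        by (simp add: w_def linear_diff[OF linK] linear_scale[OF linK])
      then have "norm (K (N z)) \<le> l * norm (K z) + norm (K w)"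
        using True norm_triangle_ineq[of "l *\<^sub>R K z" "K w"] by simp
      also have "\<dots> \<le> (2 * k * sqrt k + k * c) * norm w + d * norm w"
        unfolding w_def using True \<open>\<bar>l\<bar> \<le> k\<close> by (intro add_mono Kl d(2)) simp_all
      finally show ?thesis by (simp add: C_def w_def algebra_simps)
    next
      case False
      \<comment> \<open>For \<open>l \<le> 0\<close>, positivity of \<open>N\<close> makes every
        term added to \<open>(norm (N z))^2\<close> nonnegative.\<close>
      have "(norm w)\<^sup>2 = (norm (N z))\<^sup>2 - 2 * l * inner (N z) z + l\<^sup>2 * (norm z)\<^sup>2"
        using inner_commute[of z "N z"]
        by (simp add: w_def power2_norm_eq_inner inner_diff_left inner_diff_right power2_eq_square[of l] algebra_simps)
      moreover have "l * inner (N z) z \<le> 0"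
        using False psd_opD(3)[OF psd, of z] by (simp add: mult_le_0_iff)
      moreover have "0 \<le> l\<^sup>2 * (norm z)\<^sup>2" by simp
      ultimately have "(norm (N z))\<^sup>2 \<le> (norm w)\<^sup>2" by linarith
      then have "norm (N z) \<le> norm w" by (rule power2_le_imp_le) simp
      then have "d * norm (N z) \<le> C * norm w"
        using k c d by (intro mult_mono) (simp_all add: C_def)
      then show ?thesis using d(2)[of "N z"] by (simp add: w_def)
    qed
  qed
  then have KN: "U (S (S (N y))) = S (N (N y))" for y by (simp add: K_def)
  define D where "D y = U (S y) - N y" for y
  have D: "adjoint_pair D D"
    unfolding D_def[abs_def] adjoint_pair_def
    using adjoint_pairD(3)[OF adj] adjoint_pairD(3)[OF adjoint_pair_flip[OF adj]] adjoint_pairD(3)[OF sym]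
    by (auto intro!: bounded_linear_sub bounded_linear_compose[OF blU blS] blN simp: inner_diff_left inner_diff_right)
  \<comment> \<open>Applying \<open>U\<close> to \<open>K N = 0\<close> gives
    \<open>D N^2 = 0\<close>, and adjoints give \<open>N^2 D = 0\<close>. What remains concerns the
    kernel of \<open>N\<close>.\<close>
  have "D (N (N y)) = 0" for y
    by (simp add: D_def flip: KN NN)
  then have "inner (N (N (D y))) z = 0" for y z
    by (metis D sym adjoint_pairD(3) inner_zero_right)
  then have NND: "N (N (D y)) = 0" for y
    by (metis inner_eq_zero_iff)
  then have ND: "N (D y) = 0" for y by (rule symmetric_square_zero[OF sym])
  \<comment> \<open>On the range of \<open>D\<close> the operator \<open>N^2\<close> vanishes, hence
    so does \<open>S^2\<close>, and paranormality of \<open>S\<close> then annihilates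
    \<open>S\<close> there. So \<open>D^2 = U S D - N D = 0\<close>.\<close>
  have "S (D y) = 0" for y
  proof -
    have "(norm (S (S (D y))))\<^sup>2 = inner (U (U (S (S (D y))))) (D y)"
      by (metis adj adjoint_pairD(3) adjoint_pair_flip dot_square_norm)
    then have "S (S (D y)) = 0" by (simp add: NND flip: NN)
    then show ?thesis using S[of "D y"] by simp
  qed
  then have "D (D y) = 0" for y
    by (simp add: D_def[of "D y"] ND linear_0[OF linU])
  then have "D x = 0" using symmetric_square_zero[OF D] by blast
  then show ?thesis by (simp add: D_def)
qed

section \<open>Normality from identities between squares\<close>

lemma psd_op_adjoint_compose:
  assumes adj: "adjoint_pair T U"
  shows "psd_op (\<lambda>x. U (T x))"
proof -
  have "inner (U (T x)) y = inner (T x) (T y)" "inner x (U (T y)) = inner (T x) (T y)" for x y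
    using adjoint_pairD(3)[OF adj, of x "T y"] adjoint_pairD(3)[OF adjoint_pair_flip[OF adj], of "T x" y]
    by simp_all
  moreover have "bounded_linear (\<lambda>x. U (T x))"
    by (intro bounded_linear_compose[OF adjoint_pairD(2)[OF adj]] adjoint_pairD(1)[OF adj])
  ultimately show ?thesis by (simp add: psd_op_def adjoint_pair_def)
qed

lemma normal_if_squares_eq:
  fixes S U :: "'a::{real_inner, banach} \<Rightarrow> 'a"
  assumes adj: "adjoint_pair S U"
    and S: "\<And>x. U (U (S (S x))) = U (S (U (S x)))"
    and U: "\<And>x. S (S (U (U x))) = S (U (S (U x)))"
  shows "U (S x) = S (U x)"
proof -
  note blS = adjoint_pairD(1)[OF adj] and blU = adjoint_pairD(2)[OF adj]
  define A B where "A x = U (S x)" and "B x = S (U x)" for x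
  have A: "psd_op A"
    unfolding A_def[abs_def] by (rule psd_op_adjoint_compose[OF adj])
  have B: "psd_op B"
    unfolding B_def[abs_def] by (rule psd_op_adjoint_compose[OF adjoint_pair_flip[OF adj]])
  note linA = psd_opD(1)[OF A, THEN bounded_linear.linear] and linB = psd_opD(1)[OF B, THEN bounded_linear.linear]
  have ABA: "A (B (A x)) = A (A (A x))" and BAB: "B (A (B x)) = B (B (B x))" for x
    by (simp_all add: A_def B_def S U)
  \<comment> \<open>From \<open>A^3 B = A B A B = A B^3\<close> the operator \<open>A B\<close>
    intertwines \<open>A^2\<close> with \<open>B^2\<close>, hence also \<open>A\<close> with
    \<open>B\<close>.\<close>
  have AAB: "A (A (B x)) = A (B (B x))" for x
    by (rule psd_op_intertwine[OF A B bounded_linear_compose[OF psd_opD(1)[OF A] psd_opD(1)[OF B]]])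
      (metis ABA BAB)
  have BBA: "B (B (A x)) = B (A (A x))" for x
    by (rule psd_op_intertwine[OF B A bounded_linear_compose[OF psd_opD(1)[OF B] psd_opD(1)[OF A]]])
      (metis ABA BAB)
  define D where "D x = A x - B x" for x
  have D: "adjoint_pair D D"
    unfolding D_def[abs_def] adjoint_pair_def
    by (auto intro!: bounded_linear_sub psd_opD(1)[OF A] psd_opD(1)[OF B]
        simp: inner_diff_left inner_diff_right psd_opD(2)[OF A] psd_opD(2)[OF B])
  \<comment> \<open>The eight terms of \<open>(A - B)^3\<close> cancel in pairs by the four
    identities.\<close>
  have "D (D (D x)) = 0"
    by (simp add: D_def linear_diff[OF linA] linear_diff[OF linB] ABA BAB AAB BBA)
  then have "D x = 0" using symmetric_square_zero[OF D] by blast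
  then show ?thesis by (simp add: D_def A_def B_def)
qed

section \<open>Operator order, powers and the remaining implications\<close>

lemma op_ge_refl: "A \<ge>\<^sub>o\<^sub>p A"
  by (simp add: linear_0[OF bounded_linear.linear[OF bounded_linear_scaleC]] op_ge_def
      positive_op_iff_psd bounded_clinear_def psd_op_def adjoint_pair_def)

lemma op_ge_inner:
  assumes "A \<ge>\<^sub>o\<^sub>p B"
  shows "inner (B x) x \<le> inner (A x) x"
  using assms psd_opD(3)[of "\<lambda>x. A x - B x" x]
  by (simp add: op_ge_def positive_op_iff_psd inner_diff_left)

lemma cadjoint_funpow:
  assumes "bounded_clinear T"
  shows "cadjoint (T ^^ n) = cadjoint T ^^ n"
  by (rule cadjoint_eq_adjoint_pair[OF bounded_clinear_funpow[OF assms]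
        adjoint_pair_funpow[OF adjoint_pair_cadjoint[OF assms]]])

lemma cadjoint_cadjoint:
  assumes "bounded_clinear T"
  shows "cadjoint (cadjoint T) = T"
  by (rule cadjoint_eq_adjoint_pair[OF bounded_clinear_cadjoint[OF assms]
        adjoint_pair_flip[OF adjoint_pair_cadjoint[OF assms]]])

lemma power2_apply: "(f ^^ 2) x = f (f x)"
  by (simp add: numeral_2_eq_2)

lemma op_abs_power2_square:
  fixes T :: "'a::chilbert_space \<Rightarrow> 'a"
  assumes "bounded_clinear T"
  shows "op_abs (T ^^ 2) (op_abs (T ^^ 2) x) = cadjoint T (cadjoint T (T (T x)))"
  using op_abs_square[OF bounded_clinear_funpow[OF assms]]
  by (simp add: cadjoint_funpow[OF assms] power2_apply)

lemma op_abs_power2: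
  assumes "bounded_clinear T"
  shows "op_abs T ^^ 2 = (\<lambda>x. cadjoint T (T x))"
  using op_abs_square[OF assms] by (simp add: power2_apply fun_eq_iff)

text \<open>By normality \<open>(U T)^2 = U^2 T^2\<close> for \<open>U = cadjoint T\<close>, so
  uniqueness of the positive root identifies \<open>U T\<close> as the absolute value of
  \<open>T^2\<close>.\<close>

lemma normal_imp_op_abs_power2:
  fixes T :: "'a::chilbert_space \<Rightarrow> 'a"
  assumes T: "bounded_clinear T" and normal: "\<And>x. cadjoint T (T x) = T (cadjoint T x)"
  shows "op_abs (T ^^ 2) = op_abs T ^^ 2"
  unfolding op_abs_power2[OF T]
proof (rule op_abs_eqI[OF bounded_clinear_funpow[OF T]])
  show "psd_op (\<lambda>x. cadjoint T (T x))"
    by (rule psd_op_adjoint_compose[OF adjoint_pair_cadjoint[OF T]])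
  then show "bounded_clinear (\<lambda>x. cadjoint T (T x))"
    using bounded_clinearD(2)[OF T] bounded_clinearD(2)[OF bounded_clinear_cadjoint[OF T]]
    by (simp add: bounded_clinear_def psd_opD(1))
  show "cadjoint T (T (cadjoint T (T x))) = cadjoint (T ^^ 2) ((T ^^ 2) x)" for x
    by (simp add: cadjoint_funpow[OF T] power2_apply normal)
qed

text \<open>On vectors the hypothesis reads \<open>norm (U (T x)) \<le> norm (T (T x))\<close>;
  Cauchy-Schwarz applies to \<open>(norm (T x))^2 = inner (U (T x)) x\<close>.\<close>

lemma op_abs_power4_le_imp_paranormal:
  fixes T :: "'a::chilbert_space \<Rightarrow> 'a"
  assumes T: "bounded_clinear T" and ge: "op_abs (T ^^ 2) ^^ 2 \<ge>\<^sub>o\<^sub>p op_abs T ^^ 4"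
  shows "paranormal T"
  unfolding paranormal_def
proof
  fix x
  define U where "U = cadjoint T"
  have adj: "inner (T x) y = inner x (U y)" "inner (U x) y = inner x (T y)" for x y
    unfolding U_def using adjoint_pairD(3) adjoint_pair_flip adjoint_pair_cadjoint[OF T] by blast+
  have "(op_abs T ^^ 4) y = (op_abs T ^^ 2) ((op_abs T ^^ 2) y)" for y
    using funpow_add[of 2 2 "op_abs T"] by simp
  then have "inner (U (T (U (T x)))) x \<le> inner (U (U (T (T x)))) x"
    using op_ge_inner[OF ge, of x]
    by (simp add: op_abs_power2[OF T] power2_apply op_abs_power2_square[OF T] U_def)
  then have "norm (U (T x)) \<le> norm (T (T x))"
    by (simp add: adj norm_le)
  then have "norm (U (T x)) * norm x \<le> norm x * norm (T (T x))"
    by (simp add: mult.commute mult_left_mono)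
  moreover have "(norm (T x))\<^sup>2 = inner (U (T x)) x"
    by (simp add: adj power2_norm_eq_inner)
  ultimately show "(norm (T x))\<^sup>2 \<le> norm x * norm ((T ^^ 2) x)"
    using norm_cauchy_schwarz[of "U (T x)" x] by (simp add: power2_apply)
qed

text \<open>The vectors \<open>N x\<close> and \<open>T (T x)\<close> have equal norms, so
  Cauchy-Schwarz bounds the form of \<open>N\<close>, which dominates
  \<open>(norm (T x))^2\<close>.\<close>

lemma class_A_imp_paranormal:
  fixes T :: "'a::chilbert_space \<Rightarrow> 'a"
  assumes T: "bounded_clinear T" and "class_A T"
  shows "paranormal T"
  unfolding paranormal_def
proof
  fix x
  define U N where "U = cadjoint T" and "N = op_abs (T ^^ 2)"
  have adj: "inner (T x) y = inner x (U y)" "inner (U x) y = inner x (T y)" for x y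
    unfolding U_def using adjoint_pairD(3) adjoint_pair_flip adjoint_pair_cadjoint[OF T] by blast+
  have "inner (N x) (N x) = inner (N (N x)) x"
    unfolding N_def by (rule psd_opD(2)[OF psd_op_op_abs[OF bounded_clinear_funpow[OF T]], symmetric])
  also have "\<dots> = inner (T (T x)) (T (T x))"
    by (simp add: N_def op_abs_power2_square[OF T] adj flip: U_def)
  finally have N: "norm (N x) = norm (T (T x))" by (simp add: norm_eq_sqrt_inner)
  have "(norm (T x))\<^sup>2 = inner ((op_abs T ^^ 2) x) x"
    by (simp add: op_abs_power2[OF T] adj power2_norm_eq_inner flip: U_def)
  also have "\<dots> \<le> inner (N x) x"
    using assms(2) unfolding class_A_def N_def by (rule op_ge_inner)
  also have "\<dots> \<le> norm x * norm ((T ^^ 2) x)"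
    using norm_cauchy_schwarz[of "N x" x] N by (simp add: power2_apply mult.commute)
  finally show "(norm (T x))\<^sup>2 \<le> norm x * norm ((T ^^ 2) x)" .
qed

lemma paranormal_pair_imp_normal:
  fixes S :: "'a::chilbert_space \<Rightarrow> 'a"
  assumes S: "bounded_clinear S" and "paranormal S" and "paranormal (cadjoint S)"
  shows "normal_op S"
proof -
  define U where "U = cadjoint S"
  have U: "bounded_clinear U" and adj: "adjoint_pair S U" and US: "cadjoint U = S"
    unfolding U_def by (rule bounded_clinear_cadjoint adjoint_pair_cadjoint cadjoint_cadjoint, rule S)+
  have pS: "(norm (S x))\<^sup>2 \<le> norm x * norm (S (S x))" and pU: "(norm (U x))\<^sup>2 \<le> norm x * norm (U (U x))" for x
    using assms(2,3) by (simp_all add: paranormal_def power2_apply U_def)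
  have "op_abs (S ^^ 2) x = U (S x)" for x
    by (rule paranormal_pair_abs_eq[OF adj bounded_clinear_op_abs[OF bounded_clinear_funpow[OF S]]
          psd_op_op_abs[OF bounded_clinear_funpow[OF S]] _ pS pU])
      (simp add: op_abs_power2_square[OF S] U_def)
  then have 1: "U (U (S (S x))) = U (S (U (S x)))" for x
    using op_abs_power2_square[OF S, of x] by (simp add: U_def)
  have "op_abs (U ^^ 2) x = S (U x)" for x
    by (rule paranormal_pair_abs_eq[OF adjoint_pair_flip[OF adj] bounded_clinear_op_abs[OF bounded_clinear_funpow[OF U]]
          psd_op_op_abs[OF bounded_clinear_funpow[OF U]] _ pU pS])
      (simp add: op_abs_power2_square[OF U] US)
  then have 2: "S (S (U (U x))) = S (U (S (U x)))" for x
    using op_abs_power2_square[OF U, of x] by (simp add: US)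
  show ?thesis
    unfolding normal_op_def by (rule ext) (simp add: normal_if_squares_eq[OF adj 1 2] flip: U_def)
qed

theorem proposition5:
  fixes S :: "'a::chilbert_space \<Rightarrow> 'a"
  assumes "separable_space (euclidean :: 'a topology)"
    and "bounded_clinear S"
  shows "(normal_op S \<longleftrightarrow>
            op_abs (S ^^ 2) = op_abs S ^^ 2 \<and>
            op_abs (cadjoint S ^^ 2) = op_abs (cadjoint S) ^^ 2) \<and>
         (normal_op S \<longleftrightarrow>
            op_abs (S ^^ 2) ^^ 2 \<ge>\<^sub>o\<^sub>p op_abs S ^^ 4 \<and>
            op_abs (cadjoint S ^^ 2) ^^ 2 \<ge>\<^sub>o\<^sub>p op_abs (cadjoint S) ^^ 4) \<and>
         (normal_op S \<longleftrightarrow> class_A S \<and> class_A (cadjoint S)) \<and>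
         (normal_op S \<longleftrightarrow> paranormal S \<and> paranormal (cadjoint S))"
proof -
  note S = assms(2)
  note U = bounded_clinear_cadjoint[OF S]
  have i_ii: "op_abs (S ^^ 2) = op_abs S ^^ 2 \<and> op_abs (cadjoint S ^^ 2) = op_abs (cadjoint S) ^^ 2"
    if "normal_op S"
  proof -
    have "cadjoint S (S x) = S (cadjoint S x)" for x
      using that by (metis normal_op_def comp_apply)
    then show ?thesis
      using normal_imp_op_abs_power2[OF S] normal_imp_op_abs_power2[OF U] cadjoint_cadjoint[OF S] by simp
  qed
  \<comment> \<open>Under (ii) both operator inequalities are equalities, so reflexivity of the
    order suffices.\<close>
  have ii_iii: "op_abs (T ^^ 2) ^^ 2 \<ge>\<^sub>o\<^sub>p op_abs T ^^ 4" and ii_iv: "class_A T"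
    if "op_abs (T ^^ 2) = op_abs T ^^ 2" for T :: "'a \<Rightarrow> 'a"
    using that by (simp_all add: class_A_def op_ge_refl funpow_mult)
  \<comment> \<open>The implications run from (i) to (ii), on to (iii) and (iv), from each of these
    to (v), and back to (i).\<close>
  show ?thesis
    using i_ii ii_iii ii_iv op_abs_power4_le_imp_paranormal[OF S] op_abs_power4_le_imp_paranormal[OF U]
      class_A_imp_paranormal[OF S] class_A_imp_paranormal[OF U] paranormal_pair_imp_normal[OF S]
    by meson
qed

end
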